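(* There exists a distance-approximation algorithm for induced $P_4$-freeness whose query complexity is $\mathrm{poly}(1/\varepsilon)$.
   Context: Graphs are finite, simple and undirected; the input graph $G=(V,E)$ has $n=|V|$ vertices. The distance between two graphs $G=(V,E)$ and $G'=(V,E')$ is $\Delta(G,G')=(|E\setminus E'|+|E'\setminus E|)/n^2$, and for a graph property $\mathcal{P}$, $\Delta(G,\mathcal{P})=\min_{G'\in\mathcal{P}}\Delta(G,G')$ (over graphs on the same vertex set). A distance-approximation algorithm for $\mathcal{P}$ is a randomized algorithm that, for every graph $G$ and every $\varepsilon\in(0,1)$, given $\varepsilon$ and query access to the adjacency matrix of $G$ (queries "is $(u,v)\in E$?"), outputs $\hat\Delta$ with $|\hat\Delta-\Delta(G,\mathcal{P})|\le\varepsilon$ with probability at least $2/3$; its query complexity is the number of queries. $P_4$ is the path on $4$ vertices; induced $P_4$-free means no induced subgraph is isomorphic to $P_4$. *)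

theory Defs
  imports "HOL-Probability.Probability" "HOL-Library.Ramsey"
    "HOL-Computational_Algebra.Polynomial"
begin

text \<open>A finite simple undirected graph is given by a vertex set \<open>V\<close> and a set \<open>E\<close> of
  two-element subsets of \<open>V\<close>.\<close>

definition simple_graph :: "'a set \<Rightarrow> 'a set set \<Rightarrow> bool" where
  "simple_graph V E \<longleftrightarrow> finite V \<and> E \<subseteq> nsets V 2"

definition induced_edges :: "'a set set \<Rightarrow> 'a set \<Rightarrow> 'a set set" where
  "induced_edges E S = {e \<in> E. e \<subseteq> S}"

definition graph_isomorphic :: "'a set \<Rightarrow> 'a set set \<Rightarrow> 'b set \<Rightarrow> 'b set set \<Rightarrow> bool" where
  "graph_isomorphic V E W F \<longleftrightarrow>
     (\<exists>f. bij_betw f V W \<and> (\<forall>u\<in>V. \<forall>v\<in>V. {u, v} \<in> E \<longleftrightarrow> {f u, f v} \<in> F))"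

definition induced_free :: "'b set \<Rightarrow> 'b set set \<Rightarrow> 'a set \<Rightarrow> 'a set set \<Rightarrow> bool" where
  "induced_free W F V E \<longleftrightarrow> \<not> (\<exists>S\<subseteq>V. graph_isomorphic S (induced_edges E S) W F)"

definition path_edges :: "nat \<Rightarrow> nat set set" where
  "path_edges k = {{i, Suc i} | i. Suc i < k}"

definition induced_P4_free :: "'a set \<Rightarrow> 'a set set \<Rightarrow> bool" where
  "induced_P4_free = induced_free {..<4} (path_edges 4)"

definition graph_distance :: "'a set \<Rightarrow> 'a set set \<Rightarrow> 'a set set \<Rightarrow> real" where
  "graph_distance V E E' = real (card (E - E') + card (E' - E)) / real (card V) ^ 2"

definition distance_to_property ::
  "('a set \<Rightarrow> 'a set set \<Rightarrow> bool) \<Rightarrow> 'a set \<Rightarrow> 'a set set \<Rightarrow> real" where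
  "distance_to_property P V E = Min (graph_distance V E ` {E'. simple_graph V E' \<and> P V E'})"

text \<open>A randomized adaptive query algorithm is a decision tree. The node \<open>Draw m k\<close> draws a
  fresh uniform element \<open>i\<close> of \<open>{0..m}\<close> and continues with \<open>k i\<close>; the node \<open>Query u v k\<close> asks
  whether \<open>(u, v)\<close> is an edge and continues according to the answer. As usual in the query
  model, only queries are charged; computation between queries is unrestricted.\<close>

datatype query_alg =
    Output real
  | Query nat nat "bool \<Rightarrow> query_alg"
  | Draw nat "nat \<Rightarrow> query_alg"

text \<open>Joint distribution of the output and of the number of queries made on a graph with edge
  set \<open>E\<close>.\<close>

primrec run :: "nat set set \<Rightarrow> query_alg \<Rightarrow> (real \<times> nat) pmf" where
  "run E (Output d) = return_pmf (d, 0)"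
| "run E (Query u v k) = map_pmf (\<lambda>(d, q). (d, Suc q)) (run E (k ({u, v} \<in> E)))"
| "run E (Draw m k) = bind_pmf (pmf_of_set {0..m}) (\<lambda>i. run E (k i))"

text \<open>An algorithm \<open>A\<close> receives the number \<open>n\<close> of vertices (the dimension of the adjacency
  matrix, whose rows are indexed by \<open>{..<n}\<close>) and \<open>\<epsilon>\<close>; it sees the graph only via its queries.\<close>

definition distance_approximation_algorithm ::
  "(nat set \<Rightarrow> nat set set \<Rightarrow> bool) \<Rightarrow> (nat \<Rightarrow> real \<Rightarrow> query_alg) \<Rightarrow> bool" where
  "distance_approximation_algorithm P A \<longleftrightarrow>
     (\<forall>n E \<epsilon>. simple_graph {..<n} E \<and> 0 < \<epsilon> \<and> \<epsilon> < 1 \<longrightarrow>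
        measure_pmf.prob (run E (A n \<epsilon>))
          {(d, q). \<bar>d - distance_to_property P {..<n} E\<bar> \<le> \<epsilon>} \<ge> 2 / 3)"

text \<open>Worst case over all graphs and all random choices; the polynomial does not depend on the
  number of vertices.\<close>

definition poly_query_complexity :: "(nat \<Rightarrow> real \<Rightarrow> query_alg) \<Rightarrow> bool" where
  "poly_query_complexity A \<longleftrightarrow>
     (\<exists>p :: real poly. \<forall>n E \<epsilon>. simple_graph {..<n} E \<and> 0 < \<epsilon> \<and> \<epsilon> < 1 \<longrightarrow>
        (\<forall>(d, q) \<in> set_pmf (run E (A n \<epsilon>)). real q \<le> poly p (1 / \<epsilon>)))"

end

theory Submission imports Defs begin

text \<open>By Seinsche's theorem every \<open>P\<^sub>4\<close>-free graph is a cograph, and merging small pieces along heavy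
  paths of its cotree shows that, up to \<open>\<delta>n\<^sup>2\<close> edges, it is a blow-up of a \<open>P\<^sub>4\<close>-free template
  on \<open>O(1/\<delta>)\<close> labels. Conversely every blow-up of such a template (with independent classes) is
  \<open>P\<^sub>4\<close>-free. The distance is therefore, up to a small error, the least cost of a template together
  with a labelling of the vertices.

  The vertices are divided into \<open>m = O(1/\<epsilon>)\<close> blocks. Relabelling one block after the other, each vertex
  greedily with respect to the labels of a fresh random sample, raises the cost of an optimal
  labelling by little: the cost is linear in the labels of one block except for the pairs inside
  that block. Since the resulting labelling is determined by the template and the labels of the
  samples, there are only exponentially (in \<open>poly(1/\<epsilon>)\<close>) many candidates, and their costs can be
  estimated simultaneously from \<open>poly(1/\<epsilon>)\<close> random pairs by Hoeffding's inequality.\<close>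

section \<open>Structure of \<open>P\<^sub>4\<close>-free graphs\<close>

text \<open>The number of labels must be polynomial in 1/\<epsilon>: accuracy is made simultaneous
  by a union bound over candidates, and the sample size grows with the logarithm of their number.
  Splitting along the cotree is what keeps the labels linear in 1/\<delta>. The obstacle for the
  relabelling is that a near-optimal labelling is unknown. The relabelling is therefore run only in
  the analysis, started from such a labelling; the algorithm itself tries every possible list of
  labels for the samples, one of which is the right one. Each block needs a fresh sample because the
  current labelling already depends on the earlier samples. Wrong guesses are harmless: every
  candidate describes a genuine \<open>P\<^sub>4\<close>-free graph, so its cost is never below the
  optimum. The excess over the optimum is thus nonnegative, and a bound on its expectation together
  with Markov's inequality is enough; no concentration over the rounds is required.\<close>

text \<open>For symmetric irreflexive \<open>R\<close> the four vertices are automatically distinct.\<close>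

definition p4_free_on :: "'a set \<Rightarrow> ('a \<Rightarrow> 'a \<Rightarrow> bool) \<Rightarrow> bool" where
  "p4_free_on X R \<longleftrightarrow> \<not> (\<exists>a\<in>X. \<exists>b\<in>X. \<exists>c\<in>X. \<exists>d\<in>X.
     R a b \<and> R b c \<and> R c d \<and> \<not> R a c \<and> \<not> R b d \<and> \<not> R a d)"

section \<open>Homogeneous splits of \<open>P\<^sub>4\<close>-free graphs\<close>

definition homogeneous :: "('a \<Rightarrow> 'a \<Rightarrow> bool) \<Rightarrow> 'a set \<Rightarrow> 'a set \<Rightarrow> bool" where
  "homogeneous R A B \<longleftrightarrow> (\<forall>a\<in>A. \<forall>b\<in>B. R a b) \<or> (\<forall>a\<in>A. \<forall>b\<in>B. \<not> R a b)"

lemma homogeneousE: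
  assumes "homogeneous R A B"
  obtains c where "\<And>a b. a \<in> A \<Longrightarrow> b \<in> B \<Longrightarrow> R a b = c"
  using assms unfolding homogeneous_def by meson

lemma homogeneous_sym:
  assumes "symp R" "homogeneous R A B"
  shows "homogeneous R B A"
proof -
  have "R x y \<longleftrightarrow> R y x" for x y using assms(1) by (auto dest: sympD)
  then have "homogeneous R B A \<longleftrightarrow> (\<forall>b\<in>B. \<forall>a\<in>A. R a b) \<or> (\<forall>b\<in>B. \<forall>a\<in>A. \<not> R a b)"
    unfolding homogeneous_def by presburger
  then show ?thesis using assms(2) unfolding homogeneous_def by blast
qed

lemma homogeneous_subset:
  "homogeneous R A B \<Longrightarrow> A' \<subseteq> A \<Longrightarrow> B' \<subseteq> B \<Longrightarrow> homogeneous R A' B'"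
  unfolding homogeneous_def by blast

lemma p4_free_on_subset: "p4_free_on X R \<Longrightarrow> Y \<subseteq> X \<Longrightarrow> p4_free_on Y R"
  unfolding p4_free_on_def by blast

text \<open>\<open>P\<^sub>4\<close> is self-complementary: a path a, b, c, d of the complement is
  the path c, a, d, b of \<open>R\<close>.\<close>

lemma p4_free_on_complement:
  assumes "symp R" "irreflp R" "p4_free_on X R"
  shows "p4_free_on X (\<lambda>u v. u \<noteq> v \<and> \<not> R u v)"
  unfolding p4_free_on_def
proof (intro notI, elim bexE conjE)
  fix a b c d
  assume X: "a \<in> X" "b \<in> X" "c \<in> X" "d \<in> X"
    and h: "a \<noteq> b" "\<not> R a b" "b \<noteq> c" "\<not> R b c" "c \<noteq> d" "\<not> R c d"
      "\<not> (a \<noteq> c \<and> \<not> R a c)" "\<not> (b \<noteq> d \<and> \<not> R b d)" "\<not> (a \<noteq> d \<and> \<not> R a d)"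
  have s: "R b a \<Longrightarrow> R a b" "R c a \<longleftrightarrow> R a c" "R c b \<Longrightarrow> R b c" "R d b \<longleftrightarrow> R b d"
    using assms(1) by (auto dest: sympD)
  have "a \<noteq> c" using h by blast
  have "b \<noteq> d" using h s by blast
  have "a \<noteq> d" using h s by blast
  have "R c a" "R a d" "R d b" using h s \<open>a \<noteq> c\<close> \<open>b \<noteq> d\<close> \<open>a \<noteq> d\<close> by blast+
  moreover have "\<not> R c d" "\<not> R a b" "\<not> R c b" using h s by blast+
  ultimately show False using assms(3) X unfolding p4_free_on_def by blast
qed

text \<open>If \<open>v\<close> sees everything, it splits off alone. Otherwise take the component
  C, in the graph without \<open>v\<close>, of some non-neighbour of \<open>v\<close>. Either
  \<open>v\<close> has no neighbour in C, and C splits off; or an edge of C joins a neighbour to a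
  non-neighbour of \<open>v\<close>, and then a neighbour of \<open>v\<close> outside C would
  complete an induced path, so C together with \<open>v\<close> splits off.\<close>

lemma extend_disconnected:
  assumes sym: "symp R" and irr: "irreflp R" and fin: "finite X" and p4: "p4_free_on X R"
    and v: "v \<in> X" and AB: "A \<union> B = X - {v}" "A \<inter> B = {}" "A \<noteq> {}" "B \<noteq> {}"
    and anti: "\<And>a b. a \<in> A \<Longrightarrow> b \<in> B \<Longrightarrow> \<not> R a b"
  shows "\<exists>C D. C \<union> D = X \<and> C \<inter> D = {} \<and> C \<noteq> {} \<and> D \<noteq> {} \<and> homogeneous R C D"
proof (cases "\<forall>y\<in>X - {v}. R v y")
  case True
  have "homogeneous R {v} (X - {v})" using True unfolding homogeneous_def by blast
  moreover have "X - {v} \<noteq> {}" using AB by blast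
  moreover have "{v} \<union> (X - {v}) = X" using v by blast
  ultimately show ?thesis by blast
next
  case False
  have s: "R x y \<longleftrightarrow> R y x" for x y using sym by (auto dest: sympD)
  from False obtain y where y: "y \<in> X - {v}" "\<not> R v y" by blast
  define closed where "closed C \<longleftrightarrow> C \<subseteq> X - {v} \<and> y \<in> C \<and> C \<noteq> X - {v}
    \<and> (\<forall>c\<in>C. \<forall>x\<in>X - {v} - C. \<not> R c x)" for C
  have "\<exists>C. closed C"
  proof (cases "y \<in> A")
    case True
    have "closed A" unfolding closed_def using AB anti True by blast
    then show ?thesis by blast
  next
    case False
    then have "y \<in> B" using y AB by blast
    have "\<not> R c x" if "c \<in> B" "x \<in> X - {v} - B" for c x
      using anti[of x c] that AB s[of c x] by blast
    then have "closed B" unfolding closed_def using AB \<open>y \<in> B\<close> by blast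
    then show ?thesis by blast
  qed
  then obtain C where C: "closed C" and least: "\<And>C'. closed C' \<Longrightarrow> card C \<le> card C'"
    using ex_has_least_nat[of closed _ card] by blast
  have CX: "C \<subseteq> X - {v}" "y \<in> C" "C \<noteq> X - {v}"
    and cl: "\<And>c x. c \<in> C \<Longrightarrow> x \<in> X - {v} - C \<Longrightarrow> \<not> R c x"
    using C unfolding closed_def by blast+
  have finC: "finite C" using CX fin by (meson finite_Diff finite_subset)
  define N where "N = {c \<in> C. \<not> R v c}"
  show ?thesis
  proof (cases "\<exists>p\<in>N. \<exists>q\<in>C - N. R p q")
    case True
    then obtain p q where pq: "p \<in> C" "\<not> R v p" "q \<in> C" "R v q" "R p q" unfolding N_def by blast
    have "\<not> R v w" if w: "w \<in> X - {v} - C" for w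
    proof
      \<comment> \<open>The forbidden path is w, v, q, p.\<close>
      assume "R v w"
      then have "R w v" "R v q" "R q p" "\<not> R w q" "\<not> R v p" "\<not> R w p"
        using s[of w v] s[of p q] s[of w q] s[of w p] pq cl[of p w] cl[of q w] w by simp_all
      then show False using p4 w v pq CX unfolding p4_free_on_def by blast
    qed
    then have "homogeneous R (C \<union> {v}) (X - {v} - C)"
      unfolding homogeneous_def using cl by auto
    moreover have "(C \<union> {v}) \<union> (X - {v} - C) = X" "(C \<union> {v}) \<inter> (X - {v} - C) = {}"
      "C \<union> {v} \<noteq> {}" "X - {v} - C \<noteq> {}" using CX v by blast+
    ultimately show ?thesis by (intro exI[of _ "C \<union> {v}"] exI[of _ "X - {v} - C"] conjI)
  next
    case False
    \<comment> \<open>No edge joins \<open>N\<close> to \<open>C - N\<close>, and \<open>y\<close>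
      lies in \<open>N\<close> because it was chosen as a non-neighbour of \<open>v\<close>;
      minimality of \<open>C\<close> then forces \<open>N = C\<close>.\<close>
    have "closed N" unfolding closed_def
      using False CX cl y unfolding N_def by blast
    then have "card C \<le> card N" by (rule least)
    moreover have "N \<subseteq> C" unfolding N_def by blast
    ultimately have "N = C" using finC by (simp add: card_seteq)
    then have "\<not> R v c" if "c \<in> C" for c using that unfolding N_def by blast
    then have "homogeneous R C (X - C)"
      unfolding homogeneous_def using cl s[of v] by blast
    moreover have "C \<union> (X - C) = X" "C \<inter> (X - C) = {}" "C \<noteq> {}" "X - C \<noteq> {}"
      using CX v by blast+
    ultimately show ?thesis by (intro exI[of _ C] exI[of _ "X - C"] conjI)
  qed
qed

lemma homogeneous_complement:
  assumes "homogeneous (\<lambda>u v. u \<noteq> v \<and> \<not> R u v) A B" "A \<inter> B = {}"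
  shows "homogeneous R A B"
proof -
  have "(\<forall>a\<in>A. \<forall>b\<in>B. a \<noteq> b \<and> \<not> R a b) \<or> (\<forall>a\<in>A. \<forall>b\<in>B. \<not> (a \<noteq> b \<and> \<not> R a b))"
    using assms(1) unfolding homogeneous_def .
  moreover have "a \<noteq> b" if "a \<in> A" "b \<in> B" for a b using that assms(2) by blast
  ultimately show ?thesis unfolding homogeneous_def by (simp add: disj_commute)
qed

text \<open>Seinsche's theorem.\<close>

lemma p4_free_split:
  assumes sym: "symp R" and irr: "irreflp R" and fin: "finite X" and p4: "p4_free_on X R"
    and card: "card X \<ge> 2"
  shows "\<exists>A B. A \<union> B = X \<and> A \<inter> B = {} \<and> A \<noteq> {} \<and> B \<noteq> {} \<and> homogeneous R A B"
  using fin p4 card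
proof (induction "card X" arbitrary: X rule: less_induct)
  case less
  from less.prems obtain v where v: "v \<in> X" by fastforce
  show ?case
  proof (cases "card X = 2")
    case True
    then obtain x y where "X = {x, y}" "x \<noteq> y" by (meson card_2_iff)
    then have "{x} \<union> {y} = X" "{x} \<inter> {y} = {}" "homogeneous R {x} {y}"
      unfolding homogeneous_def by auto
    then show ?thesis by blast
  next
    case False
    then have c: "card (X - {v}) \<ge> 2" "card (X - {v}) < card X"
      using v less.prems by auto
    obtain A B where AB: "A \<union> B = X - {v}" "A \<inter> B = {}" "A \<noteq> {}" "B \<noteq> {}"
      and hom: "homogeneous R A B"
      using less.hyps[OF c(2) _ p4_free_on_subset[OF less.prems(2)] c(1)] less.prems by blast
    from hom obtain k where k: "\<And>a b. a \<in> A \<Longrightarrow> b \<in> B \<Longrightarrow> R a b = k"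
      by (rule homogeneousE) blast
    show ?thesis
    proof (cases k)
      case False
      then show ?thesis
        using extend_disconnected[OF sym irr less.prems(1,2) v AB] k by blast
    next
      case True
      \<comment> \<open>\<open>A\<close> and \<open>B\<close> are completely joined, so they are
        disconnected in the complement. The extension by \<open>v\<close> is carried out there and
        the split is translated back.\<close>
      let ?R = "\<lambda>u v. u \<noteq> v \<and> \<not> R u v"
      have "symp ?R" "irreflp ?R" using sym by (auto intro!: sympI irreflpI dest: sympD)
      then have "\<exists>C D. C \<union> D = X \<and> C \<inter> D = {} \<and> C \<noteq> {} \<and> D \<noteq> {} \<and> homogeneous ?R C D"
        using less.prems(1) p4_free_on_complement[OF sym irr less.prems(2)] v AB
        by (rule extend_disconnected) (use k True in blast)
      then obtain C D where "C \<union> D = X" "C \<inter> D = {}" "C \<noteq> {}" "D \<noteq> {}" "homogeneous ?R C D"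
        by (elim exE conjE)
      then show ?thesis using homogeneous_complement[of R C D]
        by (intro exI[of _ C] exI[of _ D] conjI)
    qed
  qed
qed

text \<open>The retraction \<open>f\<close> sends each vertex to a representative of its class, so the template is an
  induced subgraph and inherits \<open>P\<^sub>4\<close>-freeness.\<close>

definition blowup_approx :: "('a \<Rightarrow> 'a \<Rightarrow> bool) \<Rightarrow> real \<Rightarrow> 'a set \<Rightarrow> real \<Rightarrow> bool" where
  "blowup_approx R s Y k \<longleftrightarrow> (\<exists>f B. f ` Y \<subseteq> Y \<and> B \<subseteq> Y \<times> Y \<and> real (card B) \<le> s * real (card Y) \<and>
     (\<forall>u\<in>Y. \<forall>v\<in>Y. (u, v) \<notin> B \<longrightarrow> R u v = R (f u) (f v)) \<and> real (card (f ` Y)) \<le> k)"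

section \<open>Combining approximate blow-ups\<close>

lemma blowup_approx_mono: "blowup_approx R s Y k \<Longrightarrow> k \<le> l \<Longrightarrow> blowup_approx R s Y l"
  unfolding blowup_approx_def by (meson order_trans)

text \<open>All pairs are declared bad, which the budget allows because card Q squared is at most
  \<open>s * card Q\<close>.\<close>

lemma blowup_approx_small:
  assumes "finite Q" "real (card Q) \<le> s"
  shows "blowup_approx R s Q 1"
proof (cases "Q = {}")
  case True
  then show ?thesis unfolding blowup_approx_def by auto
next
  case False
  then obtain q where "q \<in> Q" by blast
  then have "(\<lambda>_. q) ` Q = {q}" by auto
  moreover have "real (card (Q \<times> Q)) \<le> s * real (card Q)"
    using assms by (simp add: mult_right_mono)
  ultimately show ?thesis unfolding blowup_approx_def using \<open>q \<in> Q\<close>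
    by (intro exI[of _ "\<lambda>_. q"] exI[of _ "Q \<times> Q"]) auto
qed

text \<open>Retractions that keep each side inside itself preserve a homogeneous relation between
  the sides, so no cross pair is bad. Since the budget for bad pairs is linear in the number of
  vertices, both budgets and both label counts simply add up.\<close>

lemma blowup_approx_union:
  assumes sym: "symp R" and fin: "finite Y" "finite Z" and disj: "Y \<inter> Z = {}"
    and hom: "homogeneous R Y Z"
    and Y: "blowup_approx R s Y k" and Z: "blowup_approx R s Z l"
  shows "blowup_approx R s (Y \<union> Z) (k + l)"
proof -
  obtain f B where f: "f ` Y \<subseteq> Y" "B \<subseteq> Y \<times> Y" "real (card B) \<le> s * real (card Y)"
     "\<And>u v. u\<in>Y \<Longrightarrow> v\<in>Y \<Longrightarrow> (u, v) \<notin> B \<Longrightarrow> R u v = R (f u) (f v)" "real (card (f ` Y)) \<le> k"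
    using Y unfolding blowup_approx_def by blast
  obtain g C where g: "g ` Z \<subseteq> Z" "C \<subseteq> Z \<times> Z" "real (card C) \<le> s * real (card Z)"
     "\<And>u v. u\<in>Z \<Longrightarrow> v\<in>Z \<Longrightarrow> (u, v) \<notin> C \<Longrightarrow> R u v = R (g u) (g v)" "real (card (g ` Z)) \<le> l"
    using Z unfolding blowup_approx_def by blast
  define h where "h x = (if x \<in> Y then f x else g x)" for x
  have hY: "h x = f x" "f x \<in> Y" if "x \<in> Y" for x using that f(1) unfolding h_def by auto
  have hZ: "h x = g x" "g x \<in> Z" if "x \<in> Z" for x using that g(1) disj unfolding h_def by auto
  obtain c where "\<And>a b. a \<in> Y \<Longrightarrow> b \<in> Z \<Longrightarrow> R a b = c" using hom by (rule homogeneousE) blast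
  then have c: "R a b = c" "R b a = c" if "a \<in> Y" "b \<in> Z" for a b
    using that sym by (metis sympD)+
  have "h ` (Y \<union> Z) = f ` Y \<union> g ` Z"
    using hY hZ by (simp add: image_Un cong: image_cong_simp)
  then have "real (card (h ` (Y \<union> Z))) \<le> k + l"
    using card_Un_le[of "f ` Y" "g ` Z"] f(5) g(5) by simp
  moreover have "real (card (B \<union> C)) \<le> s * real (card (Y \<union> Z))"
    using card_Un_le[of B C] f(3) g(3) card_Un_disjoint[OF fin disj]
    by (simp add: algebra_simps)
  moreover have "R u v = R (h u) (h v)" if uv: "u \<in> Y \<union> Z" "v \<in> Y \<union> Z" "(u, v) \<notin> B \<union> C" for u v
  proof -
    consider "u \<in> Y" "v \<in> Y" | "u \<in> Y" "v \<in> Z" | "u \<in> Z" "v \<in> Y" | "u \<in> Z" "v \<in> Z"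
      using uv by blast
    then show ?thesis
    proof cases
      case 1
      then show ?thesis using uv f(4)[of u v] hY(1)[of u] hY(1)[of v] by simp
    next
      case 2
      then show ?thesis using c(1) hY[of u] hZ[of v] by metis
    next
      case 3
      then show ?thesis using c(2) hY[of v] hZ[of u] by metis
    next
      case 4
      then show ?thesis using uv g(4)[of u v] hZ(1)[of u] hZ(1)[of v] by simp
    qed
  qed
  moreover have "h ` (Y \<union> Z) \<subseteq> Y \<union> Z" using hY hZ by fastforce
  ultimately show ?thesis unfolding blowup_approx_def using f(2) g(2)
    by (intro exI[of _ h] exI[of _ "B \<union> C"]) blast
qed

text \<open>Every pair inside \<open>P \<union> Q\<close> is given up, at most \<open>s\<close>
  pairs per vertex. Two classes are needed because \<open>Y\<close> may be joined to one part and
  not to the other; nothing is required between \<open>P\<close> and \<open>Q\<close>.\<close>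

lemma blowup_approx_absorb:
  assumes sym: "symp R" and fin: "finite Y" "finite P" "finite Q"
    and disj: "Y \<inter> (P \<union> Q) = {}" "P \<inter> Q = {}"
    and hom: "homogeneous R Y P" "homogeneous R Y Q"
    and small: "real (card (P \<union> Q)) \<le> s"
    and Y: "blowup_approx R s Y k"
  shows "blowup_approx R s (Y \<union> (P \<union> Q)) (k + 2)"
proof -
  obtain f B where f: "f ` Y \<subseteq> Y" "B \<subseteq> Y \<times> Y" "real (card B) \<le> s * real (card Y)"
     "\<And>u v. u\<in>Y \<Longrightarrow> v\<in>Y \<Longrightarrow> (u, v) \<notin> B \<Longrightarrow> R u v = R (f u) (f v)" "real (card (f ` Y)) \<le> k"
    using Y unfolding blowup_approx_def by blast
  \<comment> \<open>For empty \<open>P\<close> this is an arbitrary element; \<open>h\<close> never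
    takes it as a value on \<open>?Z\<close> then. The same holds for \<open>q\<close>.\<close>
  obtain p where p: "P \<noteq> {} \<Longrightarrow> p \<in> P" by blast
  obtain q where q: "Q \<noteq> {} \<Longrightarrow> q \<in> Q" by blast
  define h where "h x = (if x \<in> Y then f x else if x \<in> P then p else q)" for x
  let ?Z = "Y \<union> (P \<union> Q)"
  have hY: "h x = f x" "f x \<in> Y" if "x \<in> Y" for x using that f(1) unfolding h_def by auto
  have hP: "h x = p" "p \<in> P" if "x \<in> P" for x using that p disj unfolding h_def by auto
  have hQ: "h x = q" "q \<in> Q" if "x \<in> Q" for x using that q disj unfolding h_def by auto
  obtain c where "\<And>a b. a \<in> Y \<Longrightarrow> b \<in> P \<Longrightarrow> R a b = c" using hom(1) by (rule homogeneousE) blast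
  then have c: "R a b = c" "R b a = c" if "a \<in> Y" "b \<in> P" for a b
    using that sym by (metis sympD)+
  obtain d where "\<And>a b. a \<in> Y \<Longrightarrow> b \<in> Q \<Longrightarrow> R a b = d" using hom(2) by (rule homogeneousE) blast
  then have d: "R a b = d" "R b a = d" if "a \<in> Y" "b \<in> Q" for a b
    using that sym by (metis sympD)+
  have "h ` ?Z \<subseteq> f ` Y \<union> {p, q}" using hY hP hQ by auto
  then have "card (h ` ?Z) \<le> card (f ` Y \<union> {p, q})" using fin by (intro card_mono) auto
  also have "\<dots> \<le> card (f ` Y) + card {p, q}" by (rule card_Un_le)
  also have "\<dots> \<le> card (f ` Y) + 2" by (simp add: card_insert_if)
  finally have "real (card (h ` ?Z)) \<le> k + 2" using f(5) by linarith
  moreover have "real (card (B \<union> (P \<union> Q) \<times> (P \<union> Q))) \<le> s * real (card ?Z)"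
  proof -
    have "real (card (B \<union> (P \<union> Q) \<times> (P \<union> Q))) \<le> real (card B) + real (card (P \<union> Q)) * real (card (P \<union> Q))"
      using card_Un_le[of B "(P \<union> Q) \<times> (P \<union> Q)"] by (metis card_cartesian_product of_nat_add of_nat_le_iff of_nat_mult)
    also have "\<dots> \<le> s * real (card Y) + s * real (card (P \<union> Q))"
      using f(3) small by (intro add_mono mult_right_mono) auto
    also have "\<dots> = s * real (card ?Z)"
      using card_Un_disjoint[of Y "P \<union> Q"] fin disj by (simp add: algebra_simps)
    finally show ?thesis .
  qed
  moreover have "R u v = R (h u) (h v)"
    if uv: "u \<in> ?Z" "v \<in> ?Z" "(u, v) \<notin> B \<union> (P \<union> Q) \<times> (P \<union> Q)" for u v
  proof -
    consider "u \<in> Y" "v \<in> Y" | "u \<in> Y" "v \<in> P" | "u \<in> Y" "v \<in> Q" | "u \<in> P" "v \<in> Y" | "u \<in> Q" "v \<in> Y"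
      using uv by blast
    then show ?thesis
    proof cases
      case 1
      then show ?thesis using uv f(4)[of u v] hY(1)[of u] hY(1)[of v] by simp
    next
      case 2
      then show ?thesis using c(1) hY[of u] hP[of v] by metis
    next
      case 3
      then show ?thesis using d(1) hY[of u] hQ[of v] by metis
    next
      case 4
      then show ?thesis using c(2) hY[of v] hP[of u] by metis
    next
      case 5
      then show ?thesis using d(2) hY[of v] hQ[of u] by metis
    qed
  qed
  moreover have "h ` ?Z \<subseteq> ?Z" using hY hP hQ by fastforce
  ultimately show ?thesis unfolding blowup_approx_def using f(2)
    by (intro exI[of _ h] exI[of _ "B \<union> (P \<union> Q) \<times> (P \<union> Q)"]) blast
qed


text \<open>The parts \<open>P\<close> and \<open>Q\<close> collect small pieces split off from the core \<open>Y\<close> along a heavy path of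
  the cotree; they are turned into two classes once their total size exceeds \<open>s\<close>. The constant
  \<open>-4\<close> pays for closing the pending parts on both sides of a split into two large pieces.\<close>

definition pending_approx :: "('a \<Rightarrow> 'a \<Rightarrow> bool) \<Rightarrow> real \<Rightarrow> 'a set \<Rightarrow> bool" where
  "pending_approx R s X \<longleftrightarrow> (\<exists>Y P Q. X = Y \<union> (P \<union> Q) \<and> Y \<inter> (P \<union> Q) = {} \<and> P \<inter> Q = {} \<and>
     homogeneous R Y P \<and> homogeneous R Y Q \<and> (\<forall>y\<in>Y. \<forall>p\<in>P. \<not> R y p) \<and> (\<forall>y\<in>Y. \<forall>q\<in>Q. R y q) \<and>
     real (card (P \<union> Q)) \<le> s \<and> blowup_approx R s Y (6 * real (card Y) / s - 4))"

section \<open>Linearly many classes along the cotree\<close>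

lemma pending_approxI:
  assumes "finite X" "blowup_approx R s X (6 * real (card X) / s - 4)" "0 < s"
  shows "pending_approx R s X"
  unfolding pending_approx_def homogeneous_def
  by (rule exI[of _ X], rule exI[of _ "{}"], rule exI[of _ "{}"]) (use assms in auto)

text \<open>Turning \<open>P\<close> and \<open>Q\<close> into classes costs two labels, which moves
  the constant from -4 to -2.\<close>

lemma pending_approx_close:
  assumes "symp R" "finite X" "0 < s" "pending_approx R s X"
  shows "blowup_approx R s X (6 * real (card X) / s - 2)"
proof -
  obtain Y P Q where XY: "X = Y \<union> (P \<union> Q)" "Y \<inter> (P \<union> Q) = {}" "P \<inter> Q = {}"
     "homogeneous R Y P" "homogeneous R Y Q"
     "real (card (P \<union> Q)) \<le> s" "blowup_approx R s Y (6 * real (card Y) / s - 4)"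
    using assms(4) unfolding pending_approx_def by (elim exE conjE)
  have fin: "finite Y" "finite P" "finite Q" using assms(2) XY(1) by auto
  have "blowup_approx R s X (6 * real (card Y) / s - 4 + 2)"
    unfolding XY(1) by (rule blowup_approx_absorb) (use assms(1) fin XY in auto)
  moreover have "6 * real (card Y) / s \<le> 6 * real (card X) / s"
    using assms(2,3) XY(1) by (intro divide_right_mono) (auto intro!: card_mono)
  ultimately show ?thesis by (elim blowup_approx_mono) linarith
qed

text \<open>While the total stays within \<open>s\<close>, \<open>B\<close> joins \<open>P\<close>
  or \<open>Q\<close> according to its relation to \<open>Y\<close>, at no cost in labels. Its
  relation to the old \<open>P \<union> Q\<close> can be forgotten, as those pairs are given up
  anyway.\<close>

lemma pending_approx_add_small:
  assumes sym: "symp R" and fin: "finite A" "finite B" and disj: "A \<inter> B = {}" and s: "0 < s"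
    and hom: "homogeneous R A B" and A: "pending_approx R s A" and B: "real (card B) \<le> s"
  shows "pending_approx R s (A \<union> B)"
proof -
  obtain Y P Q where XY: "A = Y \<union> (P \<union> Q)" "Y \<inter> (P \<union> Q) = {}" "P \<inter> Q = {}"
     "homogeneous R Y P" "homogeneous R Y Q" "\<forall>y\<in>Y. \<forall>p\<in>P. \<not> R y p" "\<forall>y\<in>Y. \<forall>q\<in>Q. R y q"
     "real (card (P \<union> Q)) \<le> s" "blowup_approx R s Y (6 * real (card Y) / s - 4)"
    using A unfolding pending_approx_def by (elim exE conjE)
  have finY: "finite Y" "finite P" "finite Q" using fin XY(1) by auto
  have cAB: "card (P \<union> Q \<union> B) = card (P \<union> Q) + card B"
    using finY fin XY disj by (intro card_Un_disjoint) auto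
  have cY: "card (A \<union> B) = card Y + card (P \<union> Q \<union> B)"
    using finY fin XY disj by (subst card_Un_disjoint[symmetric]) (auto simp: Un_assoc)
  show ?thesis
  proof (cases "real (card (P \<union> Q \<union> B)) \<le> s")
    case True
    have hYB: "homogeneous R Y B" using hom by (rule homogeneous_subset) (use XY in auto)
    from hYB consider "\<forall>y\<in>Y. \<forall>b\<in>B. \<not> R y b" | "\<forall>y\<in>Y. \<forall>b\<in>B. R y b"
      unfolding homogeneous_def by (elim disjE)
    then show ?thesis
    proof cases
      case 1
      have "A \<union> B = Y \<union> ((P \<union> B) \<union> Q)" "Y \<inter> ((P \<union> B) \<union> Q) = {}" "(P \<union> B) \<inter> Q = {}"
        using XY disj by auto
      moreover have p: "\<forall>y\<in>Y. \<forall>p\<in>P \<union> B. \<not> R y p" using 1 XY by auto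
      moreover have "homogeneous R Y (P \<union> B)" using p unfolding homogeneous_def by (rule disjI2)
      moreover have "real (card ((P \<union> B) \<union> Q)) \<le> s" using True by (simp add: Un_ac)
      ultimately show ?thesis unfolding pending_approx_def using XY
        by (intro exI[of _ Y] exI[of _ "P \<union> B"] exI[of _ Q] conjI)
    next
      case 2
      have "A \<union> B = Y \<union> (P \<union> (Q \<union> B))" "Y \<inter> (P \<union> (Q \<union> B)) = {}" "P \<inter> (Q \<union> B) = {}"
        using XY disj by auto
      moreover have p: "\<forall>y\<in>Y. \<forall>p\<in>Q \<union> B. R y p" using 2 XY by auto
      moreover have "homogeneous R Y (Q \<union> B)" using p unfolding homogeneous_def by (rule disjI1)
      moreover have "real (card (P \<union> (Q \<union> B))) \<le> s" using True by (simp add: Un_ac)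
      ultimately show ?thesis unfolding pending_approx_def using XY
        by (intro exI[of _ Y] exI[of _ P] exI[of _ "Q \<union> B"] conjI)
    qed
  next
    case False
    \<comment> \<open>Overflow: \<open>P\<close>, \<open>Q\<close> and \<open>B\<close> become three
      classes and everything joins the core. The core gains more than \<open>s\<close> vertices, so
      its allowance grows by more than 6.\<close>
    have "blowup_approx R s A (6 * real (card Y) / s - 4 + 2)"
      unfolding XY(1) by (rule blowup_approx_absorb) (use sym finY XY in auto)
    then have "blowup_approx R s (A \<union> B) (6 * real (card Y) / s - 4 + 2 + 1)"
      using blowup_approx_union[OF sym fin disj hom] blowup_approx_small[OF fin(2) B] by blast
    moreover have "6 * real (card Y) / s + 6 \<le> 6 * real (card (A \<union> B)) / s"
      using False s unfolding cY by (simp add: field_simps)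
    ultimately have "blowup_approx R s (A \<union> B) (6 * real (card (A \<union> B)) / s - 4)"
      by (elim blowup_approx_mono) linarith
    then show ?thesis using fin s by (intro pending_approxI) auto
  qed
qed

text \<open>Induction along the cotree given by homogeneous splits. The condition
  \<open>s < card X\<close> keeps the allowance \<open>6 * card X / s - 4\<close> above 2; pieces
  that violate it are the small ones and are never approximated on their own by this lemma.\<close>

lemma p4_free_pending_approx:
  assumes sym: "symp R" and irr: "irreflp R" and fin: "finite X" and p4: "p4_free_on X R"
    and s: "0 < s" and large: "s < real (card X)"
  shows "pending_approx R s X"
  using fin p4 large
proof (induction "card X" arbitrary: X rule: less_induct)
  case less
  show ?case
  proof (cases "card X \<ge> 2")
    case False
    \<comment> \<open>Here \<open>s < 1\<close> and \<open>X\<close> is a single vertex, which is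
      its own class without bad pairs.\<close>
    then have "card X \<le> 1" by simp
    have "6 \<le> 6 * real (card X) / s" using less.prems s by (simp add: field_simps)
    then have "real (card X) \<le> 6 * real (card X) / s - 4" using \<open>card X \<le> 1\<close> by linarith
    then have "blowup_approx R s X (6 * real (card X) / s - 4)"
      unfolding blowup_approx_def using s
      by (intro exI[of _ id] exI[of _ "{}"]) auto
    then show ?thesis using less.prems s by (intro pending_approxI)
  next
    case True
    obtain A B where AB: "A \<union> B = X" "A \<inter> B = {}" "A \<noteq> {}" "B \<noteq> {}" "homogeneous R A B"
      using p4_free_split[OF sym irr less.prems(1,2) True] by (elim exE conjE)
    have fin: "finite A" "finite B" using AB(1) less.prems(1) by auto
    have cX: "card X = card A + card B" using AB fin by (metis card_Un_disjoint)
    have small: "card A < card X" "card B < card X"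
      using cX AB fin by (simp_all add: card_gt_0_iff)
    have IHA: "pending_approx R s A" if "s < real (card A)"
      using less.hyps[OF small(1) fin(1) _ that] p4_free_on_subset[OF less.prems(2)] AB(1) by blast
    have IHB: "pending_approx R s B" if "s < real (card B)"
      using less.hyps[OF small(2) fin(2) _ that] p4_free_on_subset[OF less.prems(2)] AB(1) by blast
    consider "real (card A) \<le> s" "real (card B) \<le> s" | "s < real (card A)" "real (card B) \<le> s"
      | "real (card A) \<le> s" "s < real (card B)" | "s < real (card A)" "s < real (card B)"
      by linarith
    then show ?thesis
    proof cases
      case 1
      have "blowup_approx R s X (1 + 1)" unfolding AB(1)[symmetric]
        using 1 fin by (intro blowup_approx_union sym AB blowup_approx_small)
      \<comment> \<open>Two small pieces use two labels and must still leave the reserve of 4: this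
        is the origin of the coefficient 6.\<close>
      moreover have "6 \<le> 6 * real (card X) / s" using less.prems s by (simp add: field_simps)
      ultimately have "blowup_approx R s X (6 * real (card X) / s - 4)"
        by (elim blowup_approx_mono) linarith
      then show ?thesis using less.prems s by (intro pending_approxI)
    next
      case 2
      then show ?thesis using pending_approx_add_small[OF sym fin AB(2) s AB(5) IHA] AB(1) by simp
    next
      case 3
      have "B \<inter> A = {}" using AB(2) by blast
      then show ?thesis
        using pending_approx_add_small[OF sym fin(2,1) _ s homogeneous_sym[OF sym AB(5)] IHB] AB(1) 3
        by (simp add: Un_commute)
    next
      case 4
      have "blowup_approx R s X ((6 * real (card A) / s - 2) + (6 * real (card B) / s - 2))"
        unfolding AB(1)[symmetric]
        by (intro blowup_approx_union sym fin AB pending_approx_close s IHA IHB 4)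
      moreover have "(6 * real (card A) / s - 2) + (6 * real (card B) / s - 2) = 6 * real (card X) / s - 4"
        unfolding cX by (simp add: add_divide_distrib ring_distribs)
      ultimately have "blowup_approx R s X (6 * real (card X) / s - 4)" by simp
      then show ?thesis using less.prems s by (intro pending_approxI)
    qed
  qed
qed

lemma p4_free_blowup_approx:
  assumes "symp R" "irreflp R" "finite X" "p4_free_on X R" "0 < \<delta>" "\<delta> \<le> 1" "X \<noteq> {}"
  shows "blowup_approx R (\<delta> * real (card X)) X (6 / \<delta>)"
proof -
  let ?s = "\<delta> * real (card X)"
  have c: "0 < real (card X)" using assms by (simp add: card_gt_0_iff)
  then have s: "0 < ?s" using assms by simp
  have "6 * real (card X) / ?s = 6 / \<delta>" using c assms by simp
  moreover have "1 \<le> 6 / \<delta>" using assms by (simp add: field_simps)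
  moreover have "blowup_approx R ?s X (6 * real (card X) / ?s - 2)" if "?s < real (card X)"
    using pending_approx_close p4_free_pending_approx assms s that by blast
  \<comment> \<open>This happens only for \<open>\<delta> = 1\<close>, when all pairs may be
    bad.\<close>
  moreover have "blowup_approx R ?s X 1" if "\<not> ?s < real (card X)"
    using blowup_approx_small assms(3) that by (metis not_le_imp_less)
  ultimately show ?thesis
    by (cases "?s < real (card X)") (auto elim!: blowup_approx_mono)
qed

text \<open>Irreflexivity makes the classes independent. \<open>P\<^sub>4\<close>-freeness on
  \<open>UNIV\<close> lets any labelling whatsoever pull \<open>H\<close> back to a
  \<open>P\<^sub>4\<close>-free graph, even one using labels beyond \<open>K\<close>.\<close>

definition templates :: "nat \<Rightarrow> (nat \<times> nat) set set" where
  "templates K = {H. H \<subseteq> {..<K} \<times> {..<K} \<and> sym H \<and> irrefl H \<and>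
     p4_free_on UNIV (\<lambda>a b. (a, b) \<in> H)}"

lemma finite_templates: "finite (templates K)"
  by (rule finite_subset[of _ "Pow ({..<K} \<times> {..<K})"]) (auto simp: templates_def)

lemma card_templates: "card (templates K) \<le> 2 ^ (K * K)"
proof -
  have "card (templates K) \<le> card (Pow ({..<K} \<times> {..<K}))"
    by (rule card_mono) (auto simp: templates_def)
  also have "\<dots> = 2 ^ (K * K)" by (simp add: card_Pow card_cartesian_product)
  finally show ?thesis .
qed

lemma template_of_blowup_approx:
  assumes sym: "symp R" and irr: "irreflp R" and fin: "finite X" and p4: "p4_free_on X R"
    and app: "blowup_approx R s X k" and K: "k \<le> real K"
  obtains H \<phi> where "H \<in> templates K" "\<phi> ` X \<subseteq> {..<K}"
    "real (card {(u, v) \<in> X \<times> X. R u v \<noteq> ((\<phi> u, \<phi> v) \<in> H)}) \<le> s * real (card X)"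
proof -
  obtain f B where f: "f ` X \<subseteq> X" "B \<subseteq> X \<times> X" "real (card B) \<le> s * real (card X)"
     "\<And>u v. u\<in>X \<Longrightarrow> v\<in>X \<Longrightarrow> (u, v) \<notin> B \<Longrightarrow> R u v = R (f u) (f v)" "real (card (f ` X)) \<le> k"
    using app unfolding blowup_approx_def by blast
  have finf: "finite (f ` X)" using fin by blast
  obtain g where g: "bij_betw g (f ` X) {..<card (f ` X)}"
    using ex_bij_betw_finite_nat[OF finf] by (auto simp: atLeast0LessThan)
  have cK: "card (f ` X) \<le> K" using f(5) K by linarith
  have inj: "inj_on g (f ` X)" using g by (rule bij_betw_imp_inj_on)
  have gK: "g x < K" if "x \<in> f ` X" for x
    using that g cK by (meson bij_betwE lessThan_iff order_less_le_trans)
  define H where "H = {(g x, g y) |x y. x \<in> f ` X \<and> y \<in> f ` X \<and> R x y}"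
  have H: "(g x, g y) \<in> H \<longleftrightarrow> R x y" if "x \<in> f ` X" "y \<in> f ` X" for x y
  proof
    assume "(g x, g y) \<in> H"
    then obtain x' y' where "g x = g x'" "g y = g y'" "x' \<in> f ` X" "y' \<in> f ` X" "R x' y'"
      unfolding H_def by blast
    then show "R x y" using inj_onD[OF inj] that by metis
  qed (use that in \<open>unfold H_def, blast\<close>)
  have dom: "\<exists>x y. a = g x \<and> b = g y \<and> x \<in> f ` X \<and> y \<in> f ` X" if "(a, b) \<in> H" for a b
    using that unfolding H_def by blast
  have "p4_free_on UNIV (\<lambda>a b. (a, b) \<in> H)"
    unfolding p4_free_on_def
  proof (intro notI, elim bexE conjE)
    fix a b c d assume h: "(a, b) \<in> H" "(b, c) \<in> H" "(c, d) \<in> H" "(a, c) \<notin> H" "(b, d) \<notin> H" "(a, d) \<notin> H"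
    obtain x y where 1: "a = g x" "b = g y" "x \<in> f ` X" "y \<in> f ` X" using dom[OF h(1)] by (elim exE conjE)
    obtain z w where 2: "c = g z" "d = g w" "z \<in> f ` X" "w \<in> f ` X" using dom[OF h(3)] by (elim exE conjE)
    have "R x y" "R y z" "R z w" "\<not> R x z" "\<not> R y w" "\<not> R x w"
      using h 1 2 H by simp_all
    moreover have "x \<in> X" "y \<in> X" "z \<in> X" "w \<in> X" using 1 2 f(1) by blast+
    ultimately show False using p4 unfolding p4_free_on_def by blast
  qed
  moreover have "sym H" using sym unfolding H_def by (auto intro!: symI dest: sympD)
  moreover have "irrefl H"
  proof (rule irreflI, rule notI)
    fix a assume h: "(a, a) \<in> H"
    then obtain x where "x \<in> f ` X" "a = g x" using dom by blast
    then have "R x x" using H h by blast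
    then show False using irr by (simp add: irreflpD)
  qed
  moreover have "H \<subseteq> {..<K} \<times> {..<K}" using dom gK by fastforce
  ultimately have "H \<in> templates K" unfolding templates_def by blast
  moreover have "(g \<circ> f) ` X \<subseteq> {..<K}" using gK by auto
  moreover have "real (card {(u, v) \<in> X \<times> X. R u v \<noteq> (((g \<circ> f) u, (g \<circ> f) v) \<in> H)}) \<le> s * real (card X)"
  proof -
    have "{(u, v) \<in> X \<times> X. R u v \<noteq> (((g \<circ> f) u, (g \<circ> f) v) \<in> H)} \<subseteq> B"
    proof (intro subsetI, clarify)
      fix u v assume uv: "u \<in> X" "v \<in> X" "R u v \<noteq> (((g \<circ> f) u, (g \<circ> f) v) \<in> H)"
      show "(u, v) \<in> B"
      proof (rule ccontr)
        assume "(u, v) \<notin> B"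
        then have "R u v = R (f u) (f v)" by (rule f(4)[OF uv(1,2)])
        moreover have "(((g \<circ> f) u, (g \<circ> f) v) \<in> H) = R (f u) (f v)"
          unfolding comp_def by (rule H) (use uv in auto)
        ultimately show False using uv(3) by simp
      qed
    qed
    moreover have "finite B" using f(2) fin by (meson finite_SigmaI finite_subset)
    ultimately have "card {(u, v) \<in> X \<times> X. R u v \<noteq> (((g \<circ> f) u, (g \<circ> f) v) \<in> H)} \<le> card B"
      by (intro card_mono)
    then show ?thesis using f(3) by linarith
  qed
  ultimately show thesis by (rule that)
qed

section \<open>Distance to \<open>P\<^sub>4\<close>-freeness\<close>

lemma induced_P4_free_iff:
  assumes E: "E \<subseteq> nsets V 2"
  shows "induced_P4_free V E \<longleftrightarrow> p4_free_on V (\<lambda>u v. {u, v} \<in> E)"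
proof -
  have edge4: "path_edges 4 = {{0, 1}, {1, 2}, {2, 3}}"
  proof -
    have "Suc i < 4 \<longleftrightarrow> i = 0 \<or> i = 1 \<or> i = 2" for i by auto
    then show ?thesis unfolding path_edges_def by (auto simp: numeral_eq_Suc)
  qed
  have noloop: "{x} \<notin> E" for x
    using E by (auto simp: nsets_def)
  have "(\<exists>S\<subseteq>V. graph_isomorphic S (induced_edges E S) {..<4} (path_edges 4)) \<longleftrightarrow>
    \<not> p4_free_on V (\<lambda>u v. {u, v} \<in> E)" (is "?L \<longleftrightarrow> ?R")
  proof
    assume ?L
    then obtain S f where S: "S \<subseteq> V" and f: "bij_betw f S {..<4}"
      and iso: "\<And>u v. u \<in> S \<Longrightarrow> v \<in> S \<Longrightarrow> {u, v} \<in> induced_edges E S \<longleftrightarrow> {f u, f v} \<in> path_edges 4"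
      unfolding graph_isomorphic_def by blast
    have "\<exists>x\<in>S. f x = i" if "i < 4" for i
      using f that unfolding bij_betw_def by (metis imageE lessThan_iff)
    from this[of 0] this[of 1] this[of 2] this[of 3]
    obtain a b c d where S': "a \<in> S" "b \<in> S" "c \<in> S" "d \<in> S"
      and v: "f a = 0" "f b = 1" "f c = 2" "f d = 3" by auto
    have e: "{x, y} \<in> E \<longleftrightarrow> {f x, f y} \<in> path_edges 4" if "x \<in> S" "y \<in> S" for x y
      using iso[OF that] that unfolding induced_edges_def by blast
    have "{a, b} \<in> E" "{b, c} \<in> E" "{c, d} \<in> E" "{a, c} \<notin> E" "{b, d} \<notin> E" "{a, d} \<notin> E"
      using S' by (simp_all add: e v edge4 doubleton_eq_iff)
    then show ?R unfolding p4_free_on_def using S' S by blast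
  next
    assume ?R
    then obtain a b c d where V: "a \<in> V" "b \<in> V" "c \<in> V" "d \<in> V"
      and e: "{a, b} \<in> E" "{b, c} \<in> E" "{c, d} \<in> E" "{a, c} \<notin> E" "{b, d} \<notin> E" "{a, d} \<notin> E"
      unfolding p4_free_on_def by blast
    \<comment> \<open>Any coincidence would make a required edge a loop or equal to a required
      non-edge.\<close>
    have ne: "a \<noteq> b" "b \<noteq> c" "c \<noteq> d" "a \<noteq> c" "b \<noteq> d" "a \<noteq> d"
      using e noloop by (auto simp: insert_commute)
    define f :: "_ \<Rightarrow> nat" where "f x = (if x = a then 0 else if x = b then 1 else if x = c then 2 else 3)" for x
    have v: "f a = 0" "f b = 1" "f c = 2" "f d = 3" using ne by (auto simp: f_def)
    have "{..<4::nat} = {0, 1, 2, 3}" by auto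
    then have "bij_betw f {a, b, c, d} {..<4}"
      unfolding bij_betw_def inj_on_def by (simp add: v)
    moreover have "\<forall>x\<in>{a, b, c, d}. \<forall>y\<in>{a, b, c, d}.
        {x, y} \<in> induced_edges E {a, b, c, d} \<longleftrightarrow> {f x, f y} \<in> path_edges 4"
      using e noloop by (simp add: v edge4 induced_edges_def doubleton_eq_iff insert_commute)
    ultimately show ?L unfolding graph_isomorphic_def using V
      by (intro exI[of _ "{a, b, c, d}"] conjI) blast+
  qed
  then show ?thesis unfolding induced_P4_free_def induced_free_def by blast
qed

lemma card_ordered_edges:
  assumes "finite F" "F \<subseteq> nsets V 2"
  shows "card {(u, v) \<in> V \<times> V. {u, v} \<in> F} = 2 * card F"
  using assms
proof (induction F rule: finite_induct)
  case (insert e F)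
  then obtain a b where ab: "e = {a, b}" "a \<in> V" "b \<in> V" "a \<noteq> b"
    by (auto elim: nsets2_E)
  let ?S = "{(u, v) \<in> V \<times> V. {u, v} \<in> F}"
  have eq: "{(u, v) \<in> V \<times> V. {u, v} \<in> insert e F} = insert (a, b) (insert (b, a) ?S)"
    using ab by (auto simp: doubleton_eq_iff insert_commute)
  have notin: "(a, b) \<notin> insert (b, a) ?S" "(b, a) \<notin> ?S"
    using ab insert.hyps by (auto simp: insert_commute)
  have "?S \<subseteq> (\<Union>e\<in>F. e) \<times> (\<Union>e\<in>F. e)" by auto
  moreover have "finite (\<Union>e\<in>F. e)"
    using insert.prems insert.hyps by (auto simp: nsets_def)
  ultimately have "finite ?S" by (meson finite_SigmaI finite_subset)
  then show ?case unfolding eq using notin insert by (simp add: card_insert_disjoint)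
qed simp

text \<open>Ordered pairs are counted so that the count is a plain double sum, which two independent
  uniform vertices estimate without bias.\<close>

definition mismatches :: "nat \<Rightarrow> (nat \<Rightarrow> nat \<Rightarrow> bool) \<Rightarrow> (nat \<Rightarrow> nat \<Rightarrow> bool) \<Rightarrow> nat" where
  "mismatches n R S = card {(u, v) \<in> {..<n} \<times> {..<n}. R u v \<noteq> S u v}"

lemma mismatches_triangle: "mismatches n R T \<le> mismatches n R S + mismatches n S T"
proof -
  have "mismatches n R T \<le> card ({(u, v) \<in> {..<n} \<times> {..<n}. R u v \<noteq> S u v} \<union>
      {(u, v) \<in> {..<n} \<times> {..<n}. S u v \<noteq> T u v})"
    unfolding mismatches_def
    by (intro card_mono finite_subset[of "_ \<union> _" "{..<n} \<times> {..<n}"]) auto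
  also have "\<dots> \<le> mismatches n R S + mismatches n S T"
    unfolding mismatches_def by (rule card_Un_le)
  finally show ?thesis .
qed

lemma graph_distance_eq_mismatches:
  assumes "simple_graph {..<n} E" "simple_graph {..<n} F"
  shows "graph_distance {..<n} E F
    = real (mismatches n (\<lambda>u v. {u, v} \<in> E) (\<lambda>u v. {u, v} \<in> F)) / (2 * real n ^ 2)"
proof -
  let ?S = "\<lambda>X. {(u, v) \<in> {..<n} \<times> {..<n}. {u, v} \<in> X}"
  have ns: "E \<subseteq> nsets {..<n} 2" "F \<subseteq> nsets {..<n} 2"
    using assms by (auto simp: simple_graph_def)
  have fin: "finite E" "finite F"
    using ns by (auto intro: finite_subset finite_imp_finite_nsets)
  have finS: "finite (?S X)" for X by (rule finite_subset[of _ "{..<n} \<times> {..<n}"]) auto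
  have "{(u, v) \<in> {..<n} \<times> {..<n}. ({u, v} \<in> E) \<noteq> ({u, v} \<in> F)} = ?S (E - F) \<union> ?S (F - E)"
    by auto
  then have "mismatches n (\<lambda>u v. {u, v} \<in> E) (\<lambda>u v. {u, v} \<in> F) = card (?S (E - F)) + card (?S (F - E))"
    unfolding mismatches_def using finS[of "E - F"] finS[of "F - E"]
    by (simp add: card_Un_disjoint disjoint_iff)
  also have "\<dots> = 2 * (card (E - F) + card (F - E))"
    using card_ordered_edges[of "E - F" "{..<n}"] card_ordered_edges[of "F - E" "{..<n}"] fin ns
    by (auto simp: subset_iff)
  finally have "real (mismatches n (\<lambda>u v. {u, v} \<in> E) (\<lambda>u v. {u, v} \<in> F))
      = 2 * real (card (E - F) + card (F - E))" by simp
  then show ?thesis unfolding graph_distance_def by (simp del: of_nat_add)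
qed

text \<open>For the upper bound, \<open>H\<close> is pulled back along \<open>\<phi>\<close>: since
  the pattern in \<open>p4_free_on\<close> does not ask for distinct vertices, the labels of a
  forbidden path form one in \<open>H\<close>. For the converse, a closest
  \<open>P\<^sub>4\<close>-free graph is approximated by a template; half of its \<delta>n^2 bad
  ordered pairs is the additional distance.\<close>

lemma
  assumes E: "simple_graph {..<n} E"
  shows distance_to_P4_free_le:
    "\<And>H \<phi> K. H \<in> templates K \<Longrightarrow> distance_to_property induced_P4_free {..<n} E
      \<le> real (mismatches n (\<lambda>u v. {u, v} \<in> E) (\<lambda>u v. (\<phi> u, \<phi> v) \<in> H)) / (2 * real n ^ 2)"
    and distance_to_P4_free_template:
    "\<And>\<delta> K. 0 < \<delta> \<Longrightarrow> \<delta> \<le> 1 \<Longrightarrow> 6 / \<delta> \<le> real K \<Longrightarrow> 0 < n \<Longrightarrow> \<exists>H\<in>templates K. \<exists>\<phi>. \<phi> ` {..<n} \<subseteq> {..<K} \<and>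
      real (mismatches n (\<lambda>u v. {u, v} \<in> E) (\<lambda>u v. (\<phi> u, \<phi> v) \<in> H)) / (2 * real n ^ 2)
        \<le> distance_to_property induced_P4_free {..<n} E + \<delta> / 2"
proof -
  let ?G = "{E'. simple_graph {..<n} E' \<and> induced_P4_free {..<n} E'}"
  have "?G \<subseteq> Pow (nsets {..<n} 2)" by (auto simp: simple_graph_def)
  then have finG: "finite ?G" by (rule finite_subset) (simp add: finite_imp_finite_nsets)
  {
    fix H K and \<phi> :: "nat \<Rightarrow> nat" assume H: "H \<in> templates K"
    define F where "F = {{u, v} |u v. u < n \<and> v < n \<and> (\<phi> u, \<phi> v) \<in> H}"
    have symH: "sym H" and irrH: "irrefl H" and p4H: "p4_free_on UNIV (\<lambda>a b. (a, b) \<in> H)"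
      using H by (auto simp: templates_def)
    have F: "{u, v} \<in> F \<longleftrightarrow> (\<phi> u, \<phi> v) \<in> H" if "u < n" "v < n" for u v
      using that symH unfolding F_def by (auto simp: doubleton_eq_iff dest: symD)
    have "F \<subseteq> nsets {..<n} 2"
      using irrH unfolding F_def irrefl_def by (auto simp: nsets_def card_insert_if)
    then have sF: "simple_graph {..<n} F" by (simp add: simple_graph_def)
    have "p4_free_on {..<n} (\<lambda>u v. {u, v} \<in> F)"
      unfolding p4_free_on_def
    proof (intro notI, elim bexE conjE)
      fix a b c d assume "a \<in> {..<n}" "b \<in> {..<n}" "c \<in> {..<n}" "d \<in> {..<n}"
        "{a, b} \<in> F" "{b, c} \<in> F" "{c, d} \<in> F" "{a, c} \<notin> F" "{b, d} \<notin> F" "{a, d} \<notin> F"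
      then have "(\<phi> a, \<phi> b) \<in> H" "(\<phi> b, \<phi> c) \<in> H" "(\<phi> c, \<phi> d) \<in> H"
        "(\<phi> a, \<phi> c) \<notin> H" "(\<phi> b, \<phi> d) \<notin> H" "(\<phi> a, \<phi> d) \<notin> H" by (simp_all add: F)
      then show False using p4H unfolding p4_free_on_def by blast
    qed
    then have "F \<in> ?G" using sF induced_P4_free_iff[of F "{..<n}"] by (simp add: simple_graph_def)
    then have "distance_to_property induced_P4_free {..<n} E \<le> graph_distance {..<n} E F"
      unfolding distance_to_property_def using finG by (intro Min_le) auto
    also have "\<dots> = real (mismatches n (\<lambda>u v. {u, v} \<in> E) (\<lambda>u v. {u, v} \<in> F)) / (2 * real n ^ 2)"
      by (rule graph_distance_eq_mismatches[OF E sF])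
    also have "mismatches n (\<lambda>u v. {u, v} \<in> E) (\<lambda>u v. {u, v} \<in> F)
        = mismatches n (\<lambda>u v. {u, v} \<in> E) (\<lambda>u v. (\<phi> u, \<phi> v) \<in> H)"
      unfolding mismatches_def using F by (intro arg_cong[where f = card]) auto
    finally show "distance_to_property induced_P4_free {..<n} E
      \<le> real (mismatches n (\<lambda>u v. {u, v} \<in> E) (\<lambda>u v. (\<phi> u, \<phi> v) \<in> H)) / (2 * real n ^ 2)" .
  }
  {
    fix \<delta> :: real and K :: nat assume \<delta>: "0 < \<delta>" "\<delta> \<le> 1" and K: "6 / \<delta> \<le> real K" and n: "0 < n"
    \<comment> \<open>The edgeless graph makes the set nonempty, so the minimum is attained.\<close>
    have "{} \<in> ?G"
      using induced_P4_free_iff[of "{}" "{..<n}"] by (simp add: simple_graph_def p4_free_on_def)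
    then have "distance_to_property induced_P4_free {..<n} E \<in> graph_distance {..<n} E ` ?G"
      unfolding distance_to_property_def using finG by (intro Min_in) auto
    then obtain F where F: "F \<in> ?G"
      and dF: "distance_to_property induced_P4_free {..<n} E = graph_distance {..<n} E F" by auto
    let ?R = "\<lambda>u v. {u, v} \<in> F"
    have sF: "simple_graph {..<n} F" using F by simp
    have p4: "p4_free_on {..<n} ?R"
      using F induced_P4_free_iff[of F "{..<n}"] by (simp add: simple_graph_def)
    have sym: "symp ?R" by (auto intro!: sympI simp: insert_commute)
    have irr: "irreflp ?R" using sF by (auto intro!: irreflpI simp: simple_graph_def nsets_def)
    have "blowup_approx ?R (\<delta> * real (card {..<n})) {..<n} (6 / \<delta>)"
      using \<delta> n by (intro p4_free_blowup_approx sym irr p4) auto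
    from template_of_blowup_approx[OF sym irr _ p4 this K]
    obtain H \<phi> where H: "H \<in> templates K" "\<phi> ` {..<n} \<subseteq> {..<K}"
      and m: "real (card {(u, v) \<in> {..<n} \<times> {..<n}. ?R u v \<noteq> ((\<phi> u, \<phi> v) \<in> H)}) \<le> \<delta> * real n * real n"
      by auto
    have "real (mismatches n (\<lambda>u v. {u, v} \<in> E) (\<lambda>u v. (\<phi> u, \<phi> v) \<in> H))
        \<le> real (mismatches n (\<lambda>u v. {u, v} \<in> E) ?R) + \<delta> * real n ^ 2"
      using mismatches_triangle[of n "\<lambda>u v. {u, v} \<in> E" "\<lambda>u v. (\<phi> u, \<phi> v) \<in> H" ?R] m
      by (simp add: mismatches_def power2_eq_square)
    then have "real (mismatches n (\<lambda>u v. {u, v} \<in> E) (\<lambda>u v. (\<phi> u, \<phi> v) \<in> H)) / (2 * real n ^ 2)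
        \<le> distance_to_property induced_P4_free {..<n} E + \<delta> / 2"
      unfolding dF graph_distance_eq_mismatches[OF E sF] using n by (simp add: field_simps)
    with H show "\<exists>H\<in>templates K. \<exists>\<phi>. \<phi> ` {..<n} \<subseteq> {..<K} \<and>
      real (mismatches n (\<lambda>u v. {u, v} \<in> E) (\<lambda>u v. (\<phi> u, \<phi> v) \<in> H)) / (2 * real n ^ 2)
        \<le> distance_to_property induced_P4_free {..<n} E + \<delta> / 2" by blast
  }
qed

section \<open>Independent samples\<close>

lemma expectation_bind_pmf_finite:
  fixes h :: "'b \<Rightarrow> real"
  assumes "finite (set_pmf p)" "\<And>x. x \<in> set_pmf p \<Longrightarrow> finite (set_pmf (f x))"
  shows "measure_pmf.expectation (bind_pmf p f) h
    = measure_pmf.expectation p (\<lambda>x. measure_pmf.expectation (f x) h)"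
proof -
  have "measure_pmf.expectation (bind_pmf p f) h
      = (\<Sum>a\<in>set_pmf p. pmf p a *\<^sub>R measure_pmf.expectation (f a) h)"
    using assms by (intro pmf_expectation_bind) auto
  also have "\<dots> = measure_pmf.expectation p (\<lambda>x. measure_pmf.expectation (f x) h)"
    using assms(1) by (subst integral_measure_pmf[of "set_pmf p"]) auto
  finally show ?thesis .
qed

lemma expectation_mono_finite:
  fixes g h :: "'a \<Rightarrow> real"
  assumes "finite (set_pmf p)" "\<And>x. x \<in> set_pmf p \<Longrightarrow> g x \<le> h x"
  shows "measure_pmf.expectation p g \<le> measure_pmf.expectation p h"
  using assms by (intro integral_mono_AE integrable_measure_pmf_finite) (auto simp: AE_measure_pmf_iff)

text \<open>Serves both as the Chernoff step, with an exponential \<open>g\<close>, and as Markov's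
  inequality, with a scaled excess cost.\<close>

lemma prob_le_expectation:
  assumes "finite (set_pmf p)" "\<And>x. x \<in> set_pmf p \<Longrightarrow> indicator A x \<le> (g x :: real)"
  shows "measure_pmf.prob p A \<le> measure_pmf.expectation p g"
proof -
  have "measure_pmf.prob p A = measure_pmf.expectation p (indicator A)" by simp
  also have "\<dots> \<le> measure_pmf.expectation p g" using assms by (rule expectation_mono_finite)
  finally show ?thesis .
qed

lemma prob_bind_pmf_le:
  assumes "finite (set_pmf p)" "\<And>x. x \<in> set_pmf p \<Longrightarrow> finite (set_pmf (f x))"
    and bad: "measure_pmf.prob p B \<le> \<alpha>"
    and rest: "\<And>x. x \<in> set_pmf p \<Longrightarrow> x \<notin> B \<Longrightarrow> measure_pmf.prob (f x) A \<le> \<beta>" and "0 \<le> \<beta>"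
  shows "measure_pmf.prob (bind_pmf p f) A \<le> \<alpha> + \<beta>"
proof -
  have "measure_pmf.prob (bind_pmf p f) A = measure_pmf.expectation (bind_pmf p f) (indicator A)"
    by simp
  also have "\<dots> = measure_pmf.expectation p (\<lambda>x. measure_pmf.prob (f x) A)"
    using assms by (subst expectation_bind_pmf_finite) auto
  also have "\<dots> \<le> measure_pmf.expectation p (\<lambda>x. indicator B x + \<beta>)"
  proof (rule expectation_mono_finite)
    fix x assume "x \<in> set_pmf p"
    then show "measure_pmf.prob (f x) A \<le> indicator B x + \<beta>"
      using rest[of x] \<open>0 \<le> \<beta>\<close> by (auto simp: indicator_def intro: order_trans[OF measure_pmf.prob_le_1])
  qed fact
  also have "\<dots> = measure_pmf.prob p B + \<beta>"
    using assms(1) by (subst Bochner_Integration.integral_add) (auto intro: integrable_measure_pmf_finite)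
  finally show ?thesis using bad by simp
qed

lemma finite_set_replicate_pmf:
  "finite (set_pmf p) \<Longrightarrow> finite (set_pmf (replicate_pmf t p))"
  by (rule finite_subset[OF _ finite_lists_length_eq[of "set_pmf p" t]])
    (auto simp: set_replicate_pmf)

section \<open>Hoeffding's inequality for lists of independent samples\<close>

lemma expectation_exp_sum_replicate_pmf:
  fixes f :: "'a \<Rightarrow> real"
  assumes fin: "finite (set_pmf p)"
  shows "measure_pmf.expectation (replicate_pmf t p) (\<lambda>xs. exp (l * (\<Sum>x\<leftarrow>xs. f x)))
    = measure_pmf.expectation p (\<lambda>x. exp (l * f x)) ^ t"
proof (induction t)
  case (Suc t)
  show ?case
    using fin finite_set_replicate_pmf[OF fin, of t]
    by (simp add: expectation_bind_pmf_finite Suc ring_distribs exp_add)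
qed simp

lemma Hoeffding_replicate_pmf_ge:
  fixes f :: "'a \<Rightarrow> real"
  assumes fin: "finite (set_pmf p)" and f: "\<And>x. 0 \<le> f x" "\<And>x. f x \<le> 1"
    and \<eta>: "0 < \<eta>" and t: "0 < t"
  shows "measure_pmf.prob (replicate_pmf t p)
    {xs. \<eta> \<le> (\<Sum>x\<leftarrow>xs. f x) / real t - measure_pmf.expectation p f} \<le> exp (- 2 * real t * \<eta>\<^sup>2)"
proof -
  define \<mu> where "\<mu> = measure_pmf.expectation p f"
  \<comment> \<open>The minimiser of \<open>l^2 / 8 - l * \<eta>\<close>, the exponent per
    sample.\<close>
  define l where "l = 4 * \<eta>"
  have l: "l > 0" using \<eta> by (simp add: l_def)
  interpret interval_bounded_random_variable "measure_pmf p" f 0 1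
    by unfold_locales (use f in auto)
  have "nn_integral (measure_pmf p) (\<lambda>x. ennreal (exp (l * (f x - \<mu>)))) \<le> ennreal (exp (l\<^sup>2 / 8))"
    using Hoeffdings_lemma_nn_integral[OF l] by (simp add: \<mu>_def)
  moreover have "nn_integral (measure_pmf p) (\<lambda>x. ennreal (exp (l * (f x - \<mu>))))
      = ennreal (measure_pmf.expectation p (\<lambda>x. exp (l * (f x - \<mu>))))"
    using fin by (intro nn_integral_eq_integral integrable_measure_pmf_finite) auto
  ultimately have mgf: "measure_pmf.expectation p (\<lambda>x. exp (l * (f x - \<mu>))) \<le> exp (l\<^sup>2 / 8)"
    by simp
  have "measure_pmf.prob (replicate_pmf t p) {xs. \<eta> \<le> (\<Sum>x\<leftarrow>xs. f x) / real t - \<mu>}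
     \<le> measure_pmf.expectation (replicate_pmf t p) (\<lambda>xs. exp (- l * real t * \<eta>) * exp (l * (\<Sum>x\<leftarrow>xs. f x - \<mu>)))"
  proof (rule prob_le_expectation)
    show "finite (set_pmf (replicate_pmf t p))" by (rule finite_set_replicate_pmf[OF fin])
    fix xs assume "xs \<in> set_pmf (replicate_pmf t p)"
    then have len: "length xs = t" by (simp add: set_replicate_pmf)
    have "0 \<le> - l * real t * \<eta> + l * (\<Sum>x\<leftarrow>xs. f x - \<mu>)"
      if "\<eta> \<le> (\<Sum>x\<leftarrow>xs. f x) / real t - \<mu>"
    proof -
      have "real t * \<eta> \<le> (\<Sum>x\<leftarrow>xs. f x) - real t * \<mu>"
        using that t by (simp add: field_simps)
      also have "\<dots> = (\<Sum>x\<leftarrow>xs. f x - \<mu>)"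
        using len by (simp add: sum_list_subtractf sum_list_triv)
      finally show ?thesis using l by simp
    qed
    then have "1 \<le> exp (- l * real t * \<eta> + l * (\<Sum>x\<leftarrow>xs. f x - \<mu>))"
      if "\<eta> \<le> (\<Sum>x\<leftarrow>xs. f x) / real t - \<mu>" using that by simp
    then show "indicator {xs. \<eta> \<le> (\<Sum>x\<leftarrow>xs. f x) / real t - \<mu>} xs
        \<le> exp (- l * real t * \<eta>) * exp (l * (\<Sum>x\<leftarrow>xs. f x - \<mu>))"
      by (auto simp: indicator_def simp flip: exp_add)
  qed
  also have "\<dots> = exp (- l * real t * \<eta>) * measure_pmf.expectation p (\<lambda>x. exp (l * (f x - \<mu>))) ^ t"
    using expectation_exp_sum_replicate_pmf[OF fin, of t l "\<lambda>x. f x - \<mu>"] by simp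
  also have "\<dots> \<le> exp (- l * real t * \<eta>) * exp (l\<^sup>2 / 8) ^ t"
    using mgf by (intro mult_left_mono power_mono integral_nonneg_AE) auto
  also have "\<dots> = exp (- 2 * real t * \<eta>\<^sup>2)"
    by (simp add: l_def power2_eq_square flip: exp_of_nat_mult exp_add)
  finally show ?thesis by (simp add: \<mu>_def)
qed

lemma Hoeffding_replicate_pmf:
  fixes f :: "'a \<Rightarrow> real"
  assumes fin: "finite (set_pmf p)" and f: "\<And>x. 0 \<le> f x" "\<And>x. f x \<le> 1"
    and \<eta>: "0 < \<eta>" and t: "0 < t"
  shows "measure_pmf.prob (replicate_pmf t p)
    {xs. \<eta> \<le> \<bar>(\<Sum>x\<leftarrow>xs. f x) / real t - measure_pmf.expectation p f\<bar>} \<le> 2 * exp (- 2 * real t * \<eta>\<^sup>2)"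
proof -
  define \<mu> where "\<mu> = measure_pmf.expectation p f"
  let ?P = "measure_pmf.prob (replicate_pmf t p)"
  have \<mu>': "measure_pmf.expectation p (\<lambda>x. 1 - f x) = 1 - \<mu>"
    unfolding \<mu>_def using fin by (subst Bochner_Integration.integral_diff) (auto intro: integrable_measure_pmf_finite)
  let ?A = "{xs. \<eta> \<le> (\<Sum>x\<leftarrow>xs. f x) / real t - \<mu>}"
  let ?B = "{xs. \<eta> \<le> (\<Sum>x\<leftarrow>xs. 1 - f x) / real t - (1 - \<mu>)}"
  have A: "?P ?A \<le> exp (- 2 * real t * \<eta>\<^sup>2)"
    using Hoeffding_replicate_pmf_ge[OF fin f \<eta> t] by (simp add: \<mu>_def)
  have B: "?P ?B \<le> exp (- 2 * real t * \<eta>\<^sup>2)"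
    using Hoeffding_replicate_pmf_ge[OF fin _ _ \<eta> t, of "\<lambda>x. 1 - f x"] f by (simp add: \<mu>')
  have "?P {xs. \<eta> \<le> \<bar>(\<Sum>x\<leftarrow>xs. f x) / real t - \<mu>\<bar>} \<le> ?P (?A \<union> ?B)"
  proof (rule measure_pmf.finite_measure_mono_AE)
    have "xs \<in> ?A \<union> ?B" if "xs \<in> set_pmf (replicate_pmf t p)"
      "\<eta> \<le> \<bar>(\<Sum>x\<leftarrow>xs. f x) / real t - \<mu>\<bar>" for xs
    proof -
      have "length xs = t" using that(1) by (simp add: set_replicate_pmf)
      then have "(\<Sum>x\<leftarrow>xs. 1 - f x) / real t = 1 - (\<Sum>x\<leftarrow>xs. f x) / real t"
        using t by (simp add: sum_list_subtractf sum_list_triv diff_divide_distrib)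
      then show ?thesis using that(2) by auto
    qed
    then show "AE xs in replicate_pmf t p.
        xs \<in> {xs. \<eta> \<le> \<bar>(\<Sum>x\<leftarrow>xs. f x) / real t - \<mu>\<bar>} \<longrightarrow> xs \<in> ?A \<union> ?B"
      by (auto simp: AE_measure_pmf_iff)
  qed auto
  also have "\<dots> \<le> ?P ?A + ?P ?B"
    by (rule measure_Un_le) auto
  finally show ?thesis using A B by (simp add: \<mu>_def)
qed

text \<open>Only the mean deviation is controlled. This suffices because the errors of all vertices,
  labels and rounds are added up in expectation before a single use of Markov's inequality.\<close>

lemma expected_deviation_replicate_pmf:
  fixes f :: "'a \<Rightarrow> real"
  assumes fin: "finite (set_pmf p)" and f: "\<And>x. 0 \<le> f x" "\<And>x. f x \<le> 1"
    and \<tau>: "0 < \<tau>" and t: "8 / \<tau> ^ 3 \<le> real t"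
  shows "measure_pmf.expectation (replicate_pmf t p)
    (\<lambda>xs. \<bar>(\<Sum>x\<leftarrow>xs. f x) / real t - measure_pmf.expectation p f\<bar>) \<le> \<tau>"
proof -
  define \<mu> where "\<mu> = measure_pmf.expectation p f"
  have "0 < 8 / \<tau> ^ 3" using \<tau> by simp
  then have t0: "0 < t" using t by (metis of_nat_0_less_iff order_less_le_trans)
  have \<mu>: "0 \<le> \<mu>" "\<mu> \<le> 1"
    using expectation_mono_finite[OF fin, of "\<lambda>_. 0" f] expectation_mono_finite[OF fin, of f "\<lambda>_. 1"] f
    by (simp_all add: \<mu>_def)
  let ?q = "replicate_pmf t p"
  let ?A = "{xs. \<tau> / 2 \<le> \<bar>(\<Sum>x\<leftarrow>xs. f x) / real t - \<mu>\<bar>}"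
  have finq: "finite (set_pmf ?q)" by (rule finite_set_replicate_pmf[OF fin])
  have "measure_pmf.expectation ?q (\<lambda>xs. \<bar>(\<Sum>x\<leftarrow>xs. f x) / real t - \<mu>\<bar>)
      \<le> measure_pmf.expectation ?q (\<lambda>xs. \<tau> / 2 + indicator ?A xs)"
  proof (rule expectation_mono_finite[OF finq])
    fix xs assume "xs \<in> set_pmf ?q"
    then have len: "length xs = t" by (simp add: set_replicate_pmf)
    have "0 \<le> (\<Sum>x\<leftarrow>xs. f x)" using f by (intro sum_list_nonneg) auto
    moreover have "(\<Sum>x\<leftarrow>xs. f x) \<le> (\<Sum>x\<leftarrow>xs. 1)" using f by (intro sum_list_mono) auto
    ultimately have "0 \<le> (\<Sum>x\<leftarrow>xs. f x) / real t" "(\<Sum>x\<leftarrow>xs. f x) / real t \<le> 1"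
      using t0 len by (simp_all add: sum_list_triv)
    then have "\<bar>(\<Sum>x\<leftarrow>xs. f x) / real t - \<mu>\<bar> \<le> 1" using \<mu> by linarith
    then show "\<bar>(\<Sum>x\<leftarrow>xs. f x) / real t - \<mu>\<bar> \<le> \<tau> / 2 + indicator ?A xs"
      using \<tau> by (auto simp: indicator_def)
  qed
  also have "\<dots> = \<tau> / 2 + measure_pmf.prob ?q ?A"
    using finq by (subst Bochner_Integration.integral_add) (auto intro: integrable_measure_pmf_finite)
  also have "measure_pmf.prob ?q ?A \<le> 2 * exp (- 2 * real t * (\<tau> / 2)\<^sup>2)"
    unfolding \<mu>_def by (rule Hoeffding_replicate_pmf[OF fin f _ t0]) (use \<tau> in auto)
  \<comment> \<open>The crude estimate x \<le> exp x at x = t\<tau>^2 / 2 requires x \<ge> 4 /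
    \<tau>, whence the cubic bound on \<open>t\<close>.\<close>
  also have "2 * exp (- 2 * real t * (\<tau> / 2)\<^sup>2) \<le> \<tau> / 2"
  proof -
    have "4 / \<tau> \<le> real t * \<tau>\<^sup>2 / 2"
      using t \<tau> by (simp add: field_simps power2_eq_square power3_eq_cube)
    also have "\<dots> \<le> exp (real t * \<tau>\<^sup>2 / 2)"
      using exp_ge_add_one_self[of "real t * \<tau>\<^sup>2 / 2"] by linarith
    finally have "4 / \<tau> \<le> exp (real t * \<tau>\<^sup>2 / 2)" .
    then have "inverse (exp (real t * \<tau>\<^sup>2 / 2)) \<le> inverse (4 / \<tau>)"
      using \<tau> by (intro le_imp_inverse_le) auto
    moreover have "exp (- 2 * real t * (\<tau> / 2)\<^sup>2) = inverse (exp (real t * \<tau>\<^sup>2 / 2))"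
      by (simp add: power_divide flip: exp_minus)
    ultimately show ?thesis by simp
  qed
  finally show ?thesis by (simp add: \<mu>_def)
qed

lemma expectation_replicate_pmf_2:
  fixes f :: "nat \<Rightarrow> nat \<Rightarrow> real"
  assumes "0 < n"
  shows "measure_pmf.expectation (replicate_pmf 2 (pmf_of_set {..<n})) (\<lambda>w. f (w ! 0) (w ! 1))
    = (\<Sum>u<n. \<Sum>v<n. f u v) / (real n)\<^sup>2"
proof -
  have ne: "{..<n} \<noteq> {}" using assms by auto
  then show ?thesis
    by (simp add: numeral_2_eq_2 expectation_bind_pmf_finite integral_pmf_of_set
        sum_divide_distrib power2_eq_square)
qed

section \<open>Greedy relabelling\<close>

text \<open>The factor \<open>u \<noteq> v\<close> matters for the terms in which \<open>u = v\<close> carries two different labels.\<close>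

definition mismatch :: "(nat \<Rightarrow> nat \<Rightarrow> bool) \<Rightarrow> (nat \<times> nat) set \<Rightarrow> nat \<Rightarrow> nat \<Rightarrow> nat \<Rightarrow> nat \<Rightarrow> real" where
  "mismatch R H u v a b = of_bool (u \<noteq> v \<and> R u v \<noteq> ((a, b) \<in> H))"

definition cost :: "nat \<Rightarrow> (nat \<Rightarrow> nat \<Rightarrow> bool) \<Rightarrow> (nat \<times> nat) set \<Rightarrow> (nat \<Rightarrow> nat) \<Rightarrow> real" where
  "cost n R H \<phi> = (\<Sum>u<n. \<Sum>v<n. mismatch R H u v (\<phi> u) (\<phi> v))"

text \<open>The labels enter as a list \<open>ls\<close> parallel to the sample, not as a function
  on vertices, so that the algorithm can evaluate the rule on guessed labels.\<close>

definition greedy_label ::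
  "(nat \<Rightarrow> nat \<Rightarrow> bool) \<Rightarrow> (nat \<times> nat) set \<Rightarrow> nat \<Rightarrow> nat list \<Rightarrow> nat list \<Rightarrow> nat \<Rightarrow> nat" where
  "greedy_label R H K us ls v =
     arg_min_on (\<lambda>a. \<Sum>(u, l)\<leftarrow>zip us ls. mismatch R H u v l a) {..<K}"

definition relabel :: "(nat \<Rightarrow> nat \<Rightarrow> bool) \<Rightarrow> (nat \<times> nat) set \<Rightarrow> nat \<Rightarrow> nat \<Rightarrow> nat
    \<Rightarrow> nat list \<Rightarrow> (nat \<Rightarrow> nat) \<Rightarrow> nat \<Rightarrow> nat" where
  "relabel R H K m i us \<phi> v = (if v mod m = i then greedy_label R H K us (map \<phi> us) v else \<phi> v)"

lemma mismatch_nonneg: "0 \<le> mismatch R H u v a b"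
  and mismatch_le_1: "mismatch R H u v a b \<le> 1"
  and mismatch_same: "mismatch R H u u a b = 0"
  by (auto simp: mismatch_def)

lemma mismatch_commute:
  assumes "symp R" "sym H"
  shows "mismatch R H u v a b = mismatch R H v u b a"
proof -
  have "R u v \<longleftrightarrow> R v u" using assms(1) by (auto dest: sympD)
  moreover have "(a, b) \<in> H \<longleftrightarrow> (b, a) \<in> H" using assms(2) by (auto dest: symD)
  ultimately show ?thesis by (auto simp: mismatch_def)
qed

lemma cost_eq_mismatches:
  assumes "irreflp R" "irrefl H"
  shows "cost n R H \<phi> = real (mismatches n R (\<lambda>u v. (\<phi> u, \<phi> v) \<in> H))"
proof -
  let ?S = "{(u, v) \<in> {..<n} \<times> {..<n}. R u v \<noteq> ((\<phi> u, \<phi> v) \<in> H)}"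
  have "mismatch R H u v (\<phi> u) (\<phi> v) = of_bool (R u v \<noteq> ((\<phi> u, \<phi> v) \<in> H))" for u v
    using assms by (auto simp: mismatch_def irreflpD irreflD)
  then have "cost n R H \<phi> = (\<Sum>x\<in>{..<n} \<times> {..<n}. of_bool (x \<in> ?S))"
    unfolding cost_def sum.cartesian_product by (intro sum.cong) auto
  also have "\<dots> = real (card (({..<n} \<times> {..<n}) \<inter> {x. x \<in> ?S}))"
    by (subst sum_of_bool_eq) auto
  also have "({..<n} \<times> {..<n}) \<inter> {x. x \<in> ?S} = ?S" by auto
  finally show ?thesis unfolding mismatches_def .
qed

lemma greedy_label_less: "0 < K \<Longrightarrow> greedy_label R H K us ls v < K"
  unfolding greedy_label_def using arg_min_if_finite(1)[of "{..<K}"] by (auto simp: lessThan_empty_iff)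

lemma greedy_label_le:
  assumes "a < K"
  shows "(\<Sum>u\<leftarrow>us. mismatch R H u v (\<phi> u) (greedy_label R H K us (map \<phi> us) v))
    \<le> (\<Sum>u\<leftarrow>us. mismatch R H u v (\<phi> u) a)"
proof -
  have eq: "(\<Sum>(u, l)\<leftarrow>zip us (map \<phi> us). mismatch R H u v l b) = (\<Sum>u\<leftarrow>us. mismatch R H u v (\<phi> u) b)" for b
    by (induction us) auto
  show ?thesis
    unfolding greedy_label_def eq
    by (rule arg_min_least) (use assms in auto)
qed

lemma relabel_less: "0 < K \<Longrightarrow> (\<And>v. \<phi> v < K) \<Longrightarrow> relabel R H K m i us \<phi> v < K"
  by (simp add: relabel_def greedy_label_less)

text \<open>Residue classes give almost equal blocks for every \<open>n\<close>, and the block of a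
  vertex is known without any preprocessing.\<close>

definition block :: "nat \<Rightarrow> nat \<Rightarrow> nat \<Rightarrow> nat set" where
  "block n m i = {v. v < n \<and> v mod m = i}"

lemma finite_block [simp]: "finite (block n m i)"
  by (simp add: block_def)

lemma card_block_le: "card (block n m i) \<le> n div m + 1"
proof -
  have "inj_on (\<lambda>v. v div m) (block n m i)"
    unfolding inj_on_def block_def by (metis (mono_tags, lifting) div_mult_mod_eq mem_Collect_eq)
  moreover have "(\<lambda>v. v div m) ` block n m i \<subseteq> {..n div m}"
    by (auto simp: block_def intro: div_le_mono)
  ultimately have "card (block n m i) \<le> card {..n div m}" by (intro card_inj_on_le) auto
  then show ?thesis by simp
qed

lemma sum_card_block: "0 < m \<Longrightarrow> (\<Sum>i<m. card (block n m i)) = n"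
proof -
  assume m: "0 < m"
  have "(\<Sum>i<m. card (block n m i)) = card (\<Union>i<m. block n m i)"
    by (rule card_UN_disjoint[symmetric]) (auto simp: block_def)
  also have "(\<Union>i<m. block n m i) = {..<n}" using m by (auto simp: block_def)
  finally show ?thesis by simp
qed

text \<open>A pair with one endpoint in \<open>B\<close> changes by exactly its linear term, and by
  symmetry each linear term occurs for both orderings. Only ordered pairs of distinct vertices
  inside \<open>B\<close> need a correction.\<close>

lemma cost_relabel_le:
  assumes sym: "symp R" "sym H" and B: "block n m i = B"
    and out: "\<And>v. v < n \<Longrightarrow> v \<notin> B \<Longrightarrow> \<psi> v = \<phi> v"
  shows "cost n R H \<psi> \<le> cost n R H \<phi>
    + 2 * (\<Sum>v\<in>B. \<Sum>u<n. mismatch R H u v (\<phi> u) (\<psi> v) - mismatch R H u v (\<phi> u) (\<phi> v))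
    + 2 * (real (card B) * (real (card B) - 1))"
proof -
  let ?c = "mismatch R H"
  let ?d = "\<lambda>u v. ?c u v (\<phi> u) (\<psi> v) - ?c u v (\<phi> u) (\<phi> v)"
  have Bn: "B \<subseteq> {..<n}" and finB: "finite B" using B by (auto simp: block_def)
  \<comment> \<open>With both endpoints in \<open>B\<close>, the right side without the correction
    is at least -1 and the left side is at most 1; hence the correction 2.\<close>
  have pt: "?c u v (\<psi> u) (\<psi> v) \<le> ?c u v (\<phi> u) (\<phi> v) + of_bool (v \<in> B) * ?d u v
      + of_bool (u \<in> B) * ?d v u + 2 * of_bool (u \<in> B \<and> v \<in> B \<and> u \<noteq> v)" if "u < n" "v < n" for u v
  proof -
    have comm: "?c v u (\<phi> v) (\<psi> u) = ?c u v (\<psi> u) (\<phi> v)" "?c v u (\<phi> v) (\<phi> u) = ?c u v (\<phi> u) (\<phi> v)"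
      by (rule mismatch_commute[OF sym])+
    show ?thesis
      using mismatch_nonneg[of R H u v "\<phi> u" "\<psi> v"] mismatch_nonneg[of R H u v "\<psi> u" "\<phi> v"]
        mismatch_le_1[of R H u v "\<psi> u" "\<psi> v"] mismatch_le_1[of R H u v "\<phi> u" "\<phi> v"]
        out[OF that(1)] out[OF that(2)]
      by (cases "u = v"; cases "u \<in> B"; cases "v \<in> B") (simp_all add: comm mismatch_same)
  qed
  have restrict: "(\<Sum>v<n. of_bool (v \<in> B) * g v) = sum g B" for g :: "nat \<Rightarrow> real"
    using Bn by (simp add: sum.inter_restrict[symmetric] Int_absorb1 of_bool_def if_distrib[of "\<lambda>x. x * _"] cong: if_cong)
  have off: "(\<Sum>u<n. \<Sum>v<n. of_bool (u \<in> B \<and> v \<in> B \<and> u \<noteq> v)) = real (card B) * (real (card B) - 1)"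
  proof -
    have "(\<Sum>v<n. of_bool (u \<in> B \<and> v \<in> B \<and> u \<noteq> v)) = of_bool (u \<in> B) * (real (card B) - 1)" if "u < n" for u
    proof (cases "u \<in> B")
      case True
      have "(\<Sum>v<n. of_bool (v \<in> B \<and> u \<noteq> v)) = real (card ({..<n} \<inter> {v. v \<in> B \<and> u \<noteq> v}))"
        by (subst sum_of_bool_eq) auto
      also have "{..<n} \<inter> {v. v \<in> B \<and> u \<noteq> v} = B - {u}" using Bn by auto
      also have "real (card (B - {u})) = real (card B) - 1"
        using True finB by (simp add: card_Diff_singleton card_gt_0_iff Suc_le_eq of_nat_diff)
          (metis Suc_leI card_gt_0_iff empty_iff of_nat_1 of_nat_diff One_nat_def)
      finally show ?thesis using True by simp
    qed simp
    then have "(\<Sum>u<n. \<Sum>v<n. of_bool (u \<in> B \<and> v \<in> B \<and> u \<noteq> v)) = (\<Sum>u<n. of_bool (u \<in> B) * (real (card B) - 1))"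
      by (intro sum.cong) auto
    then show ?thesis using restrict[of "\<lambda>_. real (card B) - 1"] by simp
  qed
  have s1: "(\<Sum>u<n. \<Sum>v<n. of_bool (v \<in> B) * ?d u v) = (\<Sum>v\<in>B. \<Sum>u<n. ?d u v)"
    by (subst sum.swap) (simp add: restrict flip: sum_distrib_left)
  have s2: "(\<Sum>u<n. \<Sum>v<n. of_bool (u \<in> B) * ?d v u) = (\<Sum>v\<in>B. \<Sum>u<n. ?d u v)"
    by (simp add: restrict flip: sum_distrib_left)
  have "cost n R H \<psi> \<le> (\<Sum>u<n. \<Sum>v<n. ?c u v (\<phi> u) (\<phi> v) + of_bool (v \<in> B) * ?d u v
      + of_bool (u \<in> B) * ?d v u + 2 * of_bool (u \<in> B \<and> v \<in> B \<and> u \<noteq> v))"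
    unfolding cost_def by (intro sum_mono pt) auto
  also have "\<dots> = cost n R H \<phi> + (\<Sum>v\<in>B. \<Sum>u<n. ?d u v) + (\<Sum>v\<in>B. \<Sum>u<n. ?d u v)
      + 2 * (real (card B) * (real (card B) - 1))"
    unfolding cost_def sum.distrib s1 s2 off[symmetric] sum_distrib_left ..
  finally show ?thesis by simp
qed

text \<open>On the sample the greedy label is no worse than \<open>\<phi> v\<close>; sample and true
  averages are compared at both labels, hence the factor 2. The greedy label depends on the sample,
  so the deviation must be controlled at all labels; a sum instead of a maximum lets expectations
  pass through.\<close>

lemma greedy_linear_le:
  assumes "0 < n" "0 < t" "length us = t" "0 < K" "\<And>v. \<phi> v < K"
  shows "(\<Sum>u<n. mismatch R H u v (\<phi> u) (greedy_label R H K us (map \<phi> us) v) - mismatch R H u v (\<phi> u) (\<phi> v))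
    \<le> 2 * real n * (\<Sum>a<K. \<bar>(\<Sum>u\<leftarrow>us. mismatch R H u v (\<phi> u) a) / real t
        - measure_pmf.expectation (pmf_of_set {..<n}) (\<lambda>u. mismatch R H u v (\<phi> u) a)\<bar>)"
proof -
  let ?E = "\<lambda>a. measure_pmf.expectation (pmf_of_set {..<n}) (\<lambda>u. mismatch R H u v (\<phi> u) a)"
  let ?A = "\<lambda>a. (\<Sum>u\<leftarrow>us. mismatch R H u v (\<phi> u) a) / real t"
  let ?S = "\<Sum>a<K. \<bar>?A a - ?E a\<bar>"
  let ?g = "greedy_label R H K us (map \<phi> us) v"
  have dev: "\<bar>?A a - ?E a\<bar> \<le> ?S" if "a < K" for a
    by (rule member_le_sum) (use that in auto)
  have E: "(\<Sum>u<n. mismatch R H u v (\<phi> u) a) = real n * ?E a" for a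
    using assms(1) by (subst integral_pmf_of_set) auto
  have "?A ?g \<le> ?A (\<phi> v)"
    using greedy_label_le[OF assms(5)] assms(2) by (intro divide_right_mono) auto
  moreover have "\<bar>?A ?g - ?E ?g\<bar> \<le> ?S" by (rule dev[OF greedy_label_less[OF assms(4)]])
  moreover have "\<bar>?A (\<phi> v) - ?E (\<phi> v)\<bar> \<le> ?S" by (rule dev[OF assms(5)])
  ultimately have "?E ?g - ?E (\<phi> v) \<le> 2 * ?S" by linarith
  then have "real n * (?E ?g - ?E (\<phi> v)) \<le> real n * (2 * ?S)" by (intro mult_left_mono) auto
  then show ?thesis unfolding sum_subtractf E by (simp add: algebra_simps)
qed

text \<open>The labelling is fixed before the sample is drawn, so the mean deviation bound applies
  to each vertex and label. The factor 4 is 2 for the two orderings of a pair times 2 for the greedy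
  comparison; \<open>2 / m\<close> comes from pairs inside the block.\<close>

lemma expected_cost_relabel:
  assumes sym: "symp R" "sym H" and n: "0 < n" and K: "0 < K" and \<phi>: "\<And>v. \<phi> v < K"
    and \<tau>: "0 < \<tau>" and t: "8 / \<tau> ^ 3 \<le> real t" and m: "0 < m"
  shows "measure_pmf.expectation (replicate_pmf t (pmf_of_set {..<n}))
      (\<lambda>us. cost n R H (relabel R H K m i us \<phi>))
    \<le> cost n R H \<phi> + real (card (block n m i)) * (real n * (4 * real K * \<tau> + 2 / real m))"
proof -
  let ?p = "pmf_of_set {..<n}"
  let ?q = "replicate_pmf t ?p"
  let ?B = "block n m i"
  let ?dev = "\<lambda>us v a. \<bar>(\<Sum>u\<leftarrow>us. mismatch R H u v (\<phi> u) a) / real t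
        - measure_pmf.expectation ?p (\<lambda>u. mismatch R H u v (\<phi> u) a)\<bar>"
  have "0 < 8 / \<tau> ^ 3" using \<tau> by simp
  then have t0: "0 < t" using t by (metis of_nat_0_less_iff order_less_le_trans)
  have ne: "{..<n} \<noteq> {}" using n by auto
  have finp: "finite (set_pmf ?p)" using ne by simp
  have finq: "finite (set_pmf ?q)" by (rule finite_set_replicate_pmf[OF finp])
  have int: "integrable (measure_pmf ?q) f" for f :: "nat list \<Rightarrow> real"
    by (rule integrable_measure_pmf_finite[OF finq])
  \<comment> \<open>Excluding the diagonal absorbs the rounding: the block size minus 1 is at most
    n/m, also when n < m.\<close>
  have "card ?B \<le> Suc (n div m)" using card_block_le[of n m i] by simp
  then have "real (card ?B) - 1 \<le> real (n div m)" by linarith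
  also have "\<dots> \<le> real n / real m" by (rule of_nat_div_le_of_nat)
  finally have cB: "real (card ?B) - 1 \<le> real n / real m" .
  have "measure_pmf.expectation ?q (\<lambda>us. cost n R H (relabel R H K m i us \<phi>))
    \<le> measure_pmf.expectation ?q (\<lambda>us. cost n R H \<phi> + 2 * (real (card ?B) * (real n / real m))
       + 4 * real n * (\<Sum>v\<in>?B. \<Sum>a<K. ?dev us v a))"
  proof (rule expectation_mono_finite[OF finq])
    fix us assume "us \<in> set_pmf ?q"
    then have len: "length us = t" by (simp add: set_replicate_pmf)
    let ?\<psi> = "relabel R H K m i us \<phi>"
    have "cost n R H ?\<psi> \<le> cost n R H \<phi>
      + 2 * (\<Sum>v\<in>?B. \<Sum>u<n. mismatch R H u v (\<phi> u) (?\<psi> v) - mismatch R H u v (\<phi> u) (\<phi> v))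
      + 2 * (real (card ?B) * (real (card ?B) - 1))"
      by (rule cost_relabel_le[OF sym refl]) (auto simp: block_def relabel_def)
    also have "\<dots> \<le> cost n R H \<phi> + 2 * (\<Sum>v\<in>?B. 2 * real n * (\<Sum>a<K. ?dev us v a))
      + 2 * (real (card ?B) * (real n / real m))"
    proof (intro add_mono mult_left_mono order_refl sum_mono cB)
      fix v assume "v \<in> ?B"
      then have "?\<psi> v = greedy_label R H K us (map \<phi> us) v" by (simp add: relabel_def block_def)
      then show "(\<Sum>u<n. mismatch R H u v (\<phi> u) (?\<psi> v) - mismatch R H u v (\<phi> u) (\<phi> v))
          \<le> 2 * real n * (\<Sum>a<K. ?dev us v a)"
        using greedy_linear_le[OF n t0 len K \<phi>] by simp
    qed auto
    finally show "cost n R H ?\<psi> \<le> cost n R H \<phi> + 2 * (real (card ?B) * (real n / real m))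
       + 4 * real n * (\<Sum>v\<in>?B. \<Sum>a<K. ?dev us v a)"
      by (simp add: sum_distrib_left[symmetric] mult.assoc)
  qed
  also have "\<dots> = cost n R H \<phi> + 2 * (real (card ?B) * (real n / real m))
       + 4 * real n * (\<Sum>v\<in>?B. \<Sum>a<K. measure_pmf.expectation ?q (\<lambda>us. ?dev us v a))"
    by (simp add: int Bochner_Integration.integral_add Bochner_Integration.integral_sum)
  also have "\<dots> \<le> cost n R H \<phi> + 2 * (real (card ?B) * (real n / real m))
       + 4 * real n * (\<Sum>v\<in>?B. \<Sum>a<K. \<tau>)"
    by (intro add_left_mono mult_left_mono sum_mono expected_deviation_replicate_pmf finp \<tau> t)
      (auto simp: mismatch_nonneg mismatch_le_1)
  also have "\<dots> = cost n R H \<phi> + real (card ?B) * (real n * (4 * real K * \<tau> + 2 / real m))"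
    by (simp add: algebra_simps)
  finally show ?thesis .
qed

text \<open>\<open>block_labels\<close> records the labels of the samples that occur during \<open>relabel_blocks\<close>;
  \<open>extend_labels\<close> recovers the final labelling from them, without knowing the initial one.\<close>

primrec relabel_blocks :: "(nat \<Rightarrow> nat \<Rightarrow> bool) \<Rightarrow> (nat \<times> nat) set \<Rightarrow> nat \<Rightarrow> nat \<Rightarrow> nat
    \<Rightarrow> (nat \<Rightarrow> nat) \<Rightarrow> nat list list \<Rightarrow> nat \<Rightarrow> nat" where
  "relabel_blocks R H K m i \<phi> [] = \<phi>"
| "relabel_blocks R H K m i \<phi> (us # Us)
    = relabel_blocks R H K m (Suc i) (relabel R H K m i us \<phi>) Us"

primrec block_labels :: "(nat \<Rightarrow> nat \<Rightarrow> bool) \<Rightarrow> (nat \<times> nat) set \<Rightarrow> nat \<Rightarrow> nat \<Rightarrow> nat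
    \<Rightarrow> (nat \<Rightarrow> nat) \<Rightarrow> nat list list \<Rightarrow> nat list list" where
  "block_labels R H K m i \<phi> [] = []"
| "block_labels R H K m i \<phi> (us # Us)
    = map \<phi> us # block_labels R H K m (Suc i) (relabel R H K m i us \<phi>) Us"

definition extend_labels :: "(nat \<Rightarrow> nat \<Rightarrow> bool) \<Rightarrow> (nat \<times> nat) set \<Rightarrow> nat \<Rightarrow> nat
    \<Rightarrow> nat list list \<Rightarrow> nat list list \<Rightarrow> nat \<Rightarrow> nat" where
  "extend_labels R H K m Us Ls v = greedy_label R H K (Us ! (v mod m)) (Ls ! (v mod m)) v"

section \<open>Relabelling all blocks\<close>

lemma relabel_blocks_before: "v mod m < i \<Longrightarrow> relabel_blocks R H K m i \<phi> Us v = \<phi> v"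
  by (induction Us arbitrary: i \<phi>) (auto simp: relabel_def)

text \<open>A vertex is relabelled only in the round of its residue class, with the sample labels
  current at that time; later rounds leave it alone.\<close>

lemma relabel_blocks_eq_greedy:
  "v mod m = i + j \<Longrightarrow> j < length Us \<Longrightarrow> relabel_blocks R H K m i \<phi> Us v
    = greedy_label R H K (Us ! j) (block_labels R H K m i \<phi> Us ! j) v"
proof (induction Us arbitrary: i j \<phi>)
  case (Cons us Us)
  show ?case
  proof (cases j)
    case 0
    then show ?thesis using Cons.prems by (simp add: relabel_blocks_before relabel_def)
  next
    case (Suc j')
    then show ?thesis using Cons.IH[of "Suc i" j'] Cons.prems by simp
  qed
qed simp

lemma relabel_blocks_eq_extend_labels:
  assumes "0 < m" "length Us = m"
  shows "relabel_blocks R H K m 0 \<phi> Us = extend_labels R H K m Us (block_labels R H K m 0 \<phi> Us)"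
  by (rule ext) (use assms in \<open>simp add: extend_labels_def relabel_blocks_eq_greedy\<close>)

lemma length_block_labels: "length (block_labels R H K m i \<phi> Us) = length Us"
  by (induction Us arbitrary: i \<phi>) auto

lemma set_block_labels:
  assumes "0 < K" "\<And>v. \<phi> v < K" "\<And>us. us \<in> set Us \<Longrightarrow> length us = t"
  shows "set (block_labels R H K m i \<phi> Us) \<subseteq> {ls. set ls \<subseteq> {..<K} \<and> length ls = t}"
  using assms(2,3)
proof (induction Us arbitrary: i \<phi>)
  case (Cons us Us)
  have "set (block_labels R H K m (Suc i) (relabel R H K m i us \<phi>) Us)
      \<subseteq> {ls. set ls \<subseteq> {..<K} \<and> length ls = t}"
    using Cons.prems relabel_less[OF assms(1)] by (intro Cons.IH) auto
  then show ?case using Cons.prems by auto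
qed simp

text \<open>Conditioned on the first sample, the new labelling is fixed and the remaining samples
  are still independent of it, so the induction hypothesis applies. The errors are weighted by block
  sizes, which will add up to \<open>n\<close>.\<close>

lemma expected_cost_relabel_blocks:
  assumes sym: "symp R" "sym H" and n: "0 < n" and K: "0 < K"
    and \<tau>: "0 < \<tau>" and t: "8 / \<tau> ^ 3 \<le> real t" and m: "0 < m"
    and \<phi>: "\<And>v. \<phi> v < K"
  shows "measure_pmf.expectation (replicate_pmf j (replicate_pmf t (pmf_of_set {..<n})))
      (\<lambda>Us. cost n R H (relabel_blocks R H K m i \<phi> Us))
    \<le> cost n R H \<phi> + (\<Sum>i'=i..<i + j. real (card (block n m i'))) * (real n * (4 * real K * \<tau> + 2 / real m))"
  using \<phi>
proof (induction j arbitrary: i \<phi>)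
  case (Suc j)
  let ?q = "replicate_pmf t (pmf_of_set {..<n})"
  let ?Q = "replicate_pmf j ?q"
  let ?\<beta> = "real n * (4 * real K * \<tau> + 2 / real m)"
  let ?b = "\<lambda>i'. real (card (block n m i'))"
  have finq: "finite (set_pmf ?q)" using n by (intro finite_set_replicate_pmf) (auto simp: set_pmf_of_set lessThan_empty_iff)
  have finQ: "finite (set_pmf ?Q)" by (rule finite_set_replicate_pmf[OF finq])
  have int: "integrable (measure_pmf ?q) f" for f :: "nat list \<Rightarrow> real"
    by (rule integrable_measure_pmf_finite[OF finq])
  have "measure_pmf.expectation (replicate_pmf (Suc j) ?q) (\<lambda>Us. cost n R H (relabel_blocks R H K m i \<phi> Us))
      = measure_pmf.expectation ?q (\<lambda>us. measure_pmf.expectation ?Q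
          (\<lambda>Us. cost n R H (relabel_blocks R H K m (Suc i) (relabel R H K m i us \<phi>) Us)))"
    using finq finQ by (simp add: expectation_bind_pmf_finite)
  also have "\<dots> \<le> measure_pmf.expectation ?q (\<lambda>us. cost n R H (relabel R H K m i us \<phi>)
      + (\<Sum>i'=Suc i..<Suc i + j. ?b i') * ?\<beta>)"
    by (intro expectation_mono_finite finq Suc.IH relabel_less K Suc.prems)
  also have "\<dots> = measure_pmf.expectation ?q (\<lambda>us. cost n R H (relabel R H K m i us \<phi>))
      + (\<Sum>i'=Suc i..<Suc i + j. ?b i') * ?\<beta>"
    using int by (subst Bochner_Integration.integral_add) auto
  also have "\<dots> \<le> cost n R H \<phi> + ?b i * ?\<beta> + (\<Sum>i'=Suc i..<Suc i + j. ?b i') * ?\<beta>"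
    by (intro add_right_mono expected_cost_relabel sym n K Suc.prems \<tau> t m)
  also have "\<dots> = cost n R H \<phi> + (\<Sum>i'=i..<i + Suc j. ?b i') * ?\<beta>"
  proof -
    have "(\<Sum>i'=i..<i + Suc j. ?b i') = ?b i + (\<Sum>i'=Suc i..<Suc i + j. ?b i')"
      by (subst sum.atLeast_Suc_lessThan) auto
    then show ?thesis by (simp only: distrib_right add.assoc)
  qed
  finally show ?case .
qed simp

section \<open>The algorithm\<close>

text \<open>Most label lists arise from no run of \<open>relabel_blocks\<close>. They are included
  since the initial labelling is unknown.\<close>

definition candidates :: "nat \<Rightarrow> nat \<Rightarrow> nat \<Rightarrow> ((nat \<times> nat) set \<times> nat list list) set" where
  "candidates K m t = templates K \<times>
     {Ls. set Ls \<subseteq> {ls. set ls \<subseteq> {..<K} \<and> length ls = t} \<and> length Ls = m}"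

lemma finite_candidates: "finite (candidates K m t)"
  unfolding candidates_def
  by (intro finite_cartesian_product finite_templates finite_lists_length_eq) auto

lemma card_candidates: "card (candidates K m t) \<le> 2 ^ (K * K) * K ^ (m * t)"
proof -
  have "card {Ls. set Ls \<subseteq> {ls. set ls \<subseteq> {..<K} \<and> length ls = t} \<and> length Ls = m} = K ^ (m * t)"
    by (subst card_lists_length_eq)
      (simp_all add: finite_lists_length_eq card_lists_length_eq power_mult[symmetric] mult.commute)
  then show ?thesis
    using card_templates[of K] by (simp add: candidates_def card_cartesian_product)
qed

definition empirical_cost :: "(nat \<Rightarrow> nat \<Rightarrow> bool) \<Rightarrow> nat \<Rightarrow> nat \<Rightarrow> nat \<Rightarrow> nat list list
    \<Rightarrow> nat list list \<Rightarrow> (nat \<times> nat) set \<times> nat list list \<Rightarrow> real" where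
  "empirical_cost R K m s Us Ws = (\<lambda>(H, Ls). (\<Sum>w\<leftarrow>Ws. mismatch R H (w ! 0) (w ! 1)
      (extend_labels R H K m Us Ls (w ! 0)) (extend_labels R H K m Us Ls (w ! 1))) / real s)"

text \<open>Ordered pairs count every edge twice, hence the division by 2.\<close>

definition estimate :: "(nat \<Rightarrow> nat \<Rightarrow> bool) \<Rightarrow> nat \<Rightarrow> nat \<Rightarrow> nat \<Rightarrow> nat
    \<Rightarrow> nat list list \<Rightarrow> nat list list \<Rightarrow> real" where
  "estimate R K m t s Us Ws = Min (empirical_cost R K m s Us Ws ` candidates K m t) / 2"

text \<open>Labels and costs consult \<open>R\<close> only between sampled vertices, so the answers
  to queries on those pairs determine the estimate.\<close>

lemma estimate_cong:
  assumes m: "0 < m" "length Us = m" and W: "\<And>w. w \<in> set Ws \<Longrightarrow> length w = 2"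
    and R: "\<And>u v. u \<in> set (concat Us @ concat Ws) \<Longrightarrow> v \<in> set (concat Us @ concat Ws) \<Longrightarrow> R u v = R' u v"
  shows "estimate R K m t s Us Ws = estimate R' K m t s Us Ws"
proof -
  let ?S = "set (concat Us @ concat Ws)"
  have mis: "mismatch R H u v = mismatch R' H u v" if "u \<in> ?S" "v \<in> ?S" for H u v
    using R[OF that] by (intro ext) (simp add: mismatch_def)
  have ext: "extend_labels R H K m Us Ls v = extend_labels R' H K m Us Ls v" if "v \<in> ?S" for H Ls v
  proof -
    have "Us ! (v mod m) \<in> set Us" using m by simp
    then have sub: "set (Us ! (v mod m)) \<subseteq> ?S" by auto
    have "(\<lambda>a. \<Sum>(u, l)\<leftarrow>zip (Us ! (v mod m)) (Ls ! (v mod m)). mismatch R H u v l a)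
       = (\<lambda>a. \<Sum>(u, l)\<leftarrow>zip (Us ! (v mod m)) (Ls ! (v mod m)). mismatch R' H u v l a)"
    proof (intro ext arg_cong[where f = sum_list] map_cong refl, clarify)
      fix a u l assume "(u, l) \<in> set (zip (Us ! (v mod m)) (Ls ! (v mod m)))"
      then have "u \<in> ?S" using sub by (auto dest: set_zip_leftD)
      then show "mismatch R H u v l a = mismatch R' H u v l a" using mis that by simp
    qed
    then show ?thesis unfolding extend_labels_def greedy_label_def by simp
  qed
  have "empirical_cost R K m s Us Ws c = empirical_cost R' K m s Us Ws c" for c
  proof (cases c)
    case (Pair H Ls)
    have "w ! 0 \<in> ?S \<and> w ! 1 \<in> ?S" if "w \<in> set Ws" for w
    proof -
      have "w ! 0 \<in> set w" "w ! 1 \<in> set w" using W[OF that] by auto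
      then show ?thesis using that by auto
    qed
    then show ?thesis unfolding Pair empirical_cost_def
      by (auto intro!: arg_cong[where f = "\<lambda>x. x / real s"] arg_cong[where f = sum_list] map_cong simp: mis ext simp del: set_append)
  qed
  then show ?thesis unfolding estimate_def by (metis (no_types, lifting) image_cong)
qed

section \<open>Sampling and querying as decision trees\<close>

primrec query_pairs :: "(nat \<times> nat) list \<Rightarrow> nat set set \<Rightarrow> (nat set set \<Rightarrow> real) \<Rightarrow> query_alg" where
  "query_pairs [] F g = Output (g F)"
| "query_pairs (p # ps) F g = Query (fst p) (snd p)
    (\<lambda>b. query_pairs ps (if b then insert {fst p, snd p} F else F) g)"

lemma run_query_pairs:
  "run E (query_pairs ps F g)
    = return_pmf (g (F \<union> (E \<inter> (\<lambda>p. {fst p, snd p}) ` set ps)), length ps)"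
proof (induction ps arbitrary: F)
  case (Cons p ps)
  show ?case
    by (cases "{fst p, snd p} \<in> E") (simp_all add: Cons.IH Int_insert_right)
qed simp

text \<open>Continuation-passing style replaces sequential composition of trees. The bound is
  \<open>n - 1\<close> because \<open>Draw\<close> includes its upper end.\<close>

primrec draw_list :: "nat \<Rightarrow> nat \<Rightarrow> (nat list \<Rightarrow> query_alg) \<Rightarrow> query_alg" where
  "draw_list 0 n k = k []"
| "draw_list (Suc t) n k = Draw (n - 1) (\<lambda>x. draw_list t n (\<lambda>xs. k (x # xs)))"

lemma run_draw_list:
  assumes "0 < n"
  shows "run E (draw_list t n k)
    = bind_pmf (replicate_pmf t (pmf_of_set {..<n})) (\<lambda>xs. run E (k xs))"
proof (induction t arbitrary: k)
  case (Suc t)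
  have "{0..n - 1} = {..<n}" using assms by auto
  then show ?case by (simp add: Suc bind_assoc_pmf bind_return_pmf)
qed (simp add: bind_return_pmf)

primrec draw_lists :: "nat \<Rightarrow> nat \<Rightarrow> nat \<Rightarrow> (nat list list \<Rightarrow> query_alg) \<Rightarrow> query_alg" where
  "draw_lists 0 t n k = k []"
| "draw_lists (Suc j) t n k = draw_list t n (\<lambda>us. draw_lists j t n (\<lambda>Us. k (us # Us)))"

lemma run_draw_lists:
  assumes "0 < n"
  shows "run E (draw_lists j t n k)
    = bind_pmf (replicate_pmf j (replicate_pmf t (pmf_of_set {..<n}))) (\<lambda>Us. run E (k Us))"
  by (induction j arbitrary: k)
    (simp_all add: run_draw_list[OF assms] bind_assoc_pmf bind_return_pmf)

text \<open>All ordered pairs of sampled vertices are queried, including repetitions and loops. This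
  only squares the sample size and makes the number of queries independent of graph and
  randomness.\<close>

definition sampling_alg :: "nat \<Rightarrow> nat \<Rightarrow> nat \<Rightarrow> nat \<Rightarrow> nat \<Rightarrow> query_alg" where
  "sampling_alg n K m t s = draw_lists m t n (\<lambda>Us. draw_lists s 2 n (\<lambda>Ws.
     query_pairs (List.product (concat Us @ concat Ws) (concat Us @ concat Ws)) {}
       (\<lambda>F. estimate (\<lambda>u v. {u, v} \<in> F) K m t s Us Ws)))"

lemma length_concat_const:
  "(\<And>xs. xs \<in> set xss \<Longrightarrow> length xs = t) \<Longrightarrow> length (concat xss) = length xss * t"
  by (induction xss) auto

lemma run_sampling_alg:
  assumes n: "0 < n" and m: "0 < m"
  shows "run E (sampling_alg n K m t s)
    = bind_pmf (replicate_pmf m (replicate_pmf t (pmf_of_set {..<n}))) (\<lambda>Us.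
      bind_pmf (replicate_pmf s (replicate_pmf 2 (pmf_of_set {..<n}))) (\<lambda>Ws.
        return_pmf (estimate (\<lambda>u v. {u, v} \<in> E) K m t s Us Ws, (m * t + 2 * s)\<^sup>2)))"
  unfolding sampling_alg_def run_draw_lists[OF n] run_query_pairs
proof (intro bind_pmf_cong refl arg_cong[where f = return_pmf], unfold prod.inject, intro conjI)
  fix Us Ws
  assume Us: "Us \<in> set_pmf (replicate_pmf m (replicate_pmf t (pmf_of_set {..<n})))"
    and Ws: "Ws \<in> set_pmf (replicate_pmf s (replicate_pmf 2 (pmf_of_set {..<n})))"
  have U: "length Us = m" "\<And>us. us \<in> set Us \<Longrightarrow> length us = t"
    using Us by (auto simp: set_replicate_pmf)
  have W: "length Ws = s" "\<And>w. w \<in> set Ws \<Longrightarrow> length w = 2"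
    using Ws by (auto simp: set_replicate_pmf)
  let ?xs = "concat Us @ concat Ws"
  have "length ?xs = m * t + 2 * s"
    using length_concat_const[of Us t] length_concat_const[of Ws 2] U W by simp
  then show "length (List.product ?xs ?xs) = (m * t + 2 * s)\<^sup>2"
    by (simp add: power2_eq_square del: length_append)
  show "estimate (\<lambda>u v. {u, v} \<in> {} \<union> (E \<inter> (\<lambda>p. {fst p, snd p}) ` set (List.product ?xs ?xs))) K m t s Us Ws
      = estimate (\<lambda>u v. {u, v} \<in> E) K m t s Us Ws"
  proof (rule estimate_cong[OF m U(1) W(2)])
    fix u v assume "u \<in> set ?xs" "v \<in> set ?xs"
    then have "{u, v} \<in> (\<lambda>p. {fst p, snd p}) ` set (List.product ?xs ?xs)"
      by (intro image_eqI[of _ _ "(u, v)"]) simp_all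
    then show "({u, v} \<in> {} \<union> (E \<inter> (\<lambda>p. {fst p, snd p}) ` set (List.product ?xs ?xs))) = ({u, v} \<in> E)"
      by blast
  qed
qed

text \<open>The expected excess over the optimum is at most \<epsilon>n^2 / 6, and
  \<open>lower\<close> makes the excess nonnegative, so Markov's inequality bounds the probability
  of an excess above \<epsilon>n^2 by 1/6.\<close>

lemma good_candidate:
  fixes \<epsilon> D :: real
  assumes sym: "symp R" and irr: "irreflp R" and n: "0 < n" and m: "0 < m" and K: "0 < K"
    and \<tau>: "0 < \<tau>" and t: "8 / \<tau> ^ 3 \<le> real t" and \<epsilon>: "0 < \<epsilon>"
    and lower: "\<And>H \<phi>. H \<in> templates K \<Longrightarrow> 2 * D * (real n)\<^sup>2 \<le> cost n R H \<phi>"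
    and H: "H \<in> templates K" and \<phi>: "\<phi> ` {..<n} \<subseteq> {..<K}"
    and opt: "cost n R H \<phi> \<le> (2 * D + \<delta>) * (real n)\<^sup>2"
    and small: "\<delta> + 4 * real K * \<tau> + 2 / real m \<le> \<epsilon> / 6"
  shows "measure_pmf.prob (replicate_pmf m (replicate_pmf t (pmf_of_set {..<n})))
    {Us. \<not> (\<exists>(H, Ls)\<in>candidates K m t.
       cost n R H (extend_labels R H K m Us Ls) \<le> (2 * D + \<epsilon>) * (real n)\<^sup>2)} \<le> 1 / 6"
proof -
  let ?q = "replicate_pmf t (pmf_of_set {..<n})"
  let ?Q = "replicate_pmf m ?q"
  \<comment> \<open>The relabelling lemmas need labels below \<open>K\<close> everywhere; the cost
    only reads vertices below \<open>n\<close>.\<close>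
  define \<phi>' where "\<phi>' v = (if v < n then \<phi> v else 0)" for v
  have \<phi>': "\<phi>' v < K" for v using \<phi> K by (auto simp: \<phi>'_def)
  have symH: "sym H" using H by (simp add: templates_def)
  have cost': "cost n R H \<phi>' = cost n R H \<phi>"
    unfolding cost_def \<phi>'_def by (intro sum.cong) auto
  have finq: "finite (set_pmf ?q)" using n by (intro finite_set_replicate_pmf) (auto simp: set_pmf_of_set lessThan_empty_iff)
  have finQ: "finite (set_pmf ?Q)" by (rule finite_set_replicate_pmf[OF finq])
  have int: "integrable (measure_pmf ?Q) f" for f :: "nat list list \<Rightarrow> real"
    by (rule integrable_measure_pmf_finite[OF finQ])
  let ?c = "\<lambda>Us. cost n R H (relabel_blocks R H K m 0 \<phi>' Us)"
  have "measure_pmf.expectation ?Q ?c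
      \<le> cost n R H \<phi>' + (\<Sum>i=0..<0 + m. real (card (block n m i))) * (real n * (4 * real K * \<tau> + 2 / real m))"
    by (intro expected_cost_relabel_blocks sym symH n K \<tau> t m \<phi>')
  also have "(\<Sum>i=0..<0 + m. real (card (block n m i))) = real n"
    using sum_card_block[OF m, of n] by (simp add: atLeast0LessThan flip: of_nat_sum)
  also have "cost n R H \<phi>' + real n * (real n * (4 * real K * \<tau> + 2 / real m))
      \<le> (2 * D + \<delta>) * (real n)\<^sup>2 + (real n)\<^sup>2 * (4 * real K * \<tau> + 2 / real m)"
    using opt by (simp add: cost' power2_eq_square mult.assoc)
  also have "\<dots> = 2 * D * (real n)\<^sup>2 + (real n)\<^sup>2 * (\<delta> + 4 * real K * \<tau> + 2 / real m)"
    by (simp add: algebra_simps)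
  also have "\<dots> \<le> 2 * D * (real n)\<^sup>2 + (real n)\<^sup>2 * (\<epsilon> / 6)"
    using small by (intro add_left_mono mult_left_mono) auto
  finally have E: "measure_pmf.expectation ?Q ?c \<le> 2 * D * (real n)\<^sup>2 + (real n)\<^sup>2 * (\<epsilon> / 6)" .
  have pos: "0 < \<epsilon> * (real n)\<^sup>2" using \<epsilon> n by simp
  have "measure_pmf.prob ?Q {Us. \<not> (\<exists>(H, Ls)\<in>candidates K m t.
       cost n R H (extend_labels R H K m Us Ls) \<le> (2 * D + \<epsilon>) * (real n)\<^sup>2)}
     \<le> measure_pmf.expectation ?Q (\<lambda>Us. (?c Us - 2 * D * (real n)\<^sup>2) / (\<epsilon> * (real n)\<^sup>2))"
  proof (rule prob_le_expectation[OF finQ])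
    fix Us assume Us: "Us \<in> set_pmf ?Q"
    have lenU: "length Us = m" "\<And>us. us \<in> set Us \<Longrightarrow> length us = t"
      using Us by (auto simp: set_replicate_pmf)
    let ?Ls = "block_labels R H K m 0 \<phi>' Us"
    have "(H, ?Ls) \<in> candidates K m t"
      using H set_block_labels[where \<phi> = \<phi>', OF K \<phi>' lenU(2)] lenU(1)
      by (simp add: candidates_def length_block_labels)
    moreover have eq: "relabel_blocks R H K m 0 \<phi>' Us = extend_labels R H K m Us ?Ls"
      by (rule relabel_blocks_eq_extend_labels[OF m lenU(1)])
    ultimately have "(2 * D + \<epsilon>) * (real n)\<^sup>2 < ?c Us"
      if "\<not> (\<exists>(H, Ls)\<in>candidates K m t. cost n R H (extend_labels R H K m Us Ls) \<le> (2 * D + \<epsilon>) * (real n)\<^sup>2)"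
      using that by force
    moreover have "2 * D * (real n)\<^sup>2 \<le> ?c Us" by (rule lower[OF H])
    ultimately show "indicator {Us. \<not> (\<exists>(H, Ls)\<in>candidates K m t.
       cost n R H (extend_labels R H K m Us Ls) \<le> (2 * D + \<epsilon>) * (real n)\<^sup>2)} Us
      \<le> (?c Us - 2 * D * (real n)\<^sup>2) / (\<epsilon> * (real n)\<^sup>2)"
      using pos by (auto simp: indicator_def le_divide_eq distrib_right)
  qed
  also have "\<dots> = (measure_pmf.expectation ?Q ?c - 2 * D * (real n)\<^sup>2) / (\<epsilon> * (real n)\<^sup>2)"
    using int by (simp add: Bochner_Integration.integral_diff)
  also have "\<dots> \<le> ((real n)\<^sup>2 * (\<epsilon> / 6)) / (\<epsilon> * (real n)\<^sup>2)"
    using E pos by (intro divide_right_mono) auto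
  also have "\<dots> = 1 / 6" using \<epsilon> n by simp
  finally show ?thesis .
qed

text \<open>\<open>Us\<close> is fixed before \<open>Ws\<close> is drawn, so the labellings of all
  candidates are fixed too and a union bound over Hoeffding's inequality applies; 12 is 2 from the
  two tails times 6.\<close>

lemma empirical_cost_accurate:
  fixes \<epsilon> :: real
  assumes n: "0 < n" and \<epsilon>: "0 < \<epsilon>" and s: "0 < s"
    and large: "12 * real (card (candidates K m t)) * exp (- 2 * real s * \<epsilon>\<^sup>2) \<le> 1"
  shows "measure_pmf.prob (replicate_pmf s (replicate_pmf 2 (pmf_of_set {..<n})))
    {Ws. \<exists>(H, Ls)\<in>candidates K m t. \<epsilon> \<le> \<bar>empirical_cost R K m s Us Ws (H, Ls)
       - cost n R H (extend_labels R H K m Us Ls) / (real n)\<^sup>2\<bar>} \<le> 1 / 6"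
proof -
  let ?q = "replicate_pmf 2 (pmf_of_set {..<n})"
  let ?Q = "replicate_pmf s ?q"
  let ?C = "candidates K m t"
  let ?B = "\<lambda>(H, Ls). {Ws. \<epsilon> \<le> \<bar>empirical_cost R K m s Us Ws (H, Ls)
       - cost n R H (extend_labels R H K m Us Ls) / (real n)\<^sup>2\<bar>}"
  have finq: "finite (set_pmf ?q)" using n by (intro finite_set_replicate_pmf) (auto simp: set_pmf_of_set lessThan_empty_iff)
  have B: "measure_pmf.prob ?Q (?B c) \<le> 2 * exp (- 2 * real s * \<epsilon>\<^sup>2)" for c
  proof (cases c)
    case (Pair H Ls)
    let ?\<phi> = "extend_labels R H K m Us Ls"
    let ?f = "\<lambda>w. mismatch R H (w ! 0) (w ! 1) (?\<phi> (w ! 0)) (?\<phi> (w ! 1))"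
    have "measure_pmf.expectation ?q ?f = cost n R H ?\<phi> / (real n)\<^sup>2"
      using expectation_replicate_pmf_2[OF n, of "\<lambda>u v. mismatch R H u v (?\<phi> u) (?\<phi> v)"]
      by (simp add: cost_def)
    then show ?thesis
      using Hoeffding_replicate_pmf[OF finq, of ?f \<epsilon> s] \<epsilon> s
      by (simp add: Pair empirical_cost_def mismatch_nonneg mismatch_le_1)
  qed
  have "{Ws. \<exists>(H, Ls)\<in>?C. \<epsilon> \<le> \<bar>empirical_cost R K m s Us Ws (H, Ls)
       - cost n R H (extend_labels R H K m Us Ls) / (real n)\<^sup>2\<bar>} = (\<Union>c\<in>?C. ?B c)" by auto
  then have "measure_pmf.prob ?Q {Ws. \<exists>(H, Ls)\<in>?C. \<epsilon> \<le> \<bar>empirical_cost R K m s Us Ws (H, Ls)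
       - cost n R H (extend_labels R H K m Us Ls) / (real n)\<^sup>2\<bar>} = measure_pmf.prob ?Q (\<Union>c\<in>?C. ?B c)"
    by (rule arg_cong)
  also have "\<dots> \<le> (\<Sum>c\<in>?C. measure_pmf.prob ?Q (?B c))"
    by (rule measure_pmf.finite_measure_subadditive_finite) (auto simp: finite_candidates)
  also have "\<dots> \<le> (\<Sum>c\<in>?C. 2 * exp (- 2 * real s * \<epsilon>\<^sup>2))" by (intro sum_mono B)
  also have "\<dots> \<le> 1 / 6" using large by simp
  finally show ?thesis .
qed

text \<open>\<open>lower\<close> covers every candidate, so the minimum is at least 2D - \<epsilon>;
  the good candidate brings it to at most 2D + 2\<epsilon>. Halving leaves an error of at most
  \<epsilon>.\<close>

lemma estimate_accurate:
  fixes \<epsilon> D :: real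
  assumes n: "0 < n"
    and lower: "\<And>H \<phi>. H \<in> templates K \<Longrightarrow> 2 * D * (real n)\<^sup>2 \<le> cost n R H \<phi>"
    and good: "\<exists>(H, Ls)\<in>candidates K m t.
       cost n R H (extend_labels R H K m Us Ls) \<le> (2 * D + \<epsilon>) * (real n)\<^sup>2"
    and acc: "\<not> (\<exists>(H, Ls)\<in>candidates K m t. \<epsilon> \<le> \<bar>empirical_cost R K m s Us Ws (H, Ls)
       - cost n R H (extend_labels R H K m Us Ls) / (real n)\<^sup>2\<bar>)"
  shows "\<bar>estimate R K m t s Us Ws - D\<bar> \<le> \<epsilon>"
proof -
  let ?C = "candidates K m t"
  let ?e = "empirical_cost R K m s Us Ws"
  obtain H0 Ls0 where c0: "(H0, Ls0) \<in> ?C"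
    and cost0: "cost n R H0 (extend_labels R H0 K m Us Ls0) \<le> (2 * D + \<epsilon>) * (real n)\<^sup>2"
    using good by blast
  have n2: "0 < (real n)\<^sup>2" using n by simp
  have "2 * D - \<epsilon> \<le> ?e c" if c: "c \<in> ?C" for c
  proof (cases c)
    case (Pair H Ls)
    have "2 * D \<le> cost n R H (extend_labels R H K m Us Ls) / (real n)\<^sup>2"
      using lower[of H] c n2 by (auto simp: Pair candidates_def le_divide_eq)
    moreover have "\<not> \<epsilon> \<le> \<bar>?e (H, Ls) - cost n R H (extend_labels R H K m Us Ls) / (real n)\<^sup>2\<bar>"
      using acc c Pair by blast
    ultimately show ?thesis unfolding Pair by linarith
  qed
  then have "2 * D - \<epsilon> \<le> Min (?e ` ?C)"
    using c0 finite_candidates by (subst Min_ge_iff) auto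
  moreover have "Min (?e ` ?C) \<le> ?e (H0, Ls0)" using c0 finite_candidates by (intro Min_le) auto
  moreover have "cost n R H0 (extend_labels R H0 K m Us Ls0) / (real n)\<^sup>2 \<le> 2 * D + \<epsilon>"
    using cost0 n2 by (simp add: divide_le_eq)
  moreover have "\<not> \<epsilon> \<le> \<bar>?e (H0, Ls0) - cost n R H0 (extend_labels R H0 K m Us Ls0) / (real n)\<^sup>2\<bar>"
    using acc c0 by blast
  ultimately show ?thesis unfolding estimate_def by linarith
qed

lemma sampling_alg_accurate:
  fixes \<epsilon> \<delta> \<tau> :: real
  assumes E: "simple_graph {..<n} E" and n: "0 < n" and m: "0 < m" and \<epsilon>: "0 < \<epsilon>"
    and \<delta>: "0 < \<delta>" "\<delta> \<le> 1" and K: "6 / \<delta> \<le> real K"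
    and \<tau>: "0 < \<tau>" and t: "8 / \<tau> ^ 3 \<le> real t"
    and small: "\<delta> + 4 * real K * \<tau> + 2 / real m \<le> \<epsilon> / 6"
    and s: "0 < s" "12 * real (card (candidates K m t)) * exp (- 2 * real s * \<epsilon>\<^sup>2) \<le> 1"
  shows "measure_pmf.prob (run E (sampling_alg n K m t s))
    {(d, q). \<bar>d - distance_to_property induced_P4_free {..<n} E\<bar> \<le> \<epsilon>} \<ge> 2 / 3"
proof -
  let ?R = "\<lambda>u v. {u, v} \<in> E"
  define D where "D = distance_to_property induced_P4_free {..<n} E"
  let ?A = "{(d :: real, q :: nat). \<bar>d - D\<bar> \<le> \<epsilon>}"
  have sym: "symp ?R" by (auto intro!: sympI simp: insert_commute)
  have irr: "irreflp ?R" using E by (auto intro!: irreflpI simp: simple_graph_def nsets_def)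
  have n2: "0 < (real n)\<^sup>2" using n by simp
  have "0 < 6 / \<delta>" using \<delta> by simp
  then have K0: "0 < K" using K by (metis of_nat_0_less_iff order_less_le_trans)
  have cost: "cost n ?R H \<phi> = real (mismatches n ?R (\<lambda>u v. (\<phi> u, \<phi> v) \<in> H))"
    if "H \<in> templates K" for H \<phi>
    using that by (intro cost_eq_mismatches irr) (simp add: templates_def)
  have lower: "2 * D * (real n)\<^sup>2 \<le> cost n ?R H \<phi>" if "H \<in> templates K" for H \<phi>
    using distance_to_P4_free_le[OF E that, of \<phi>] n2
    by (simp add: D_def cost[OF that] le_divide_eq mult_ac)
  obtain H \<phi> where H: "H \<in> templates K" and \<phi>: "\<phi> ` {..<n} \<subseteq> {..<K}"
    and "real (mismatches n ?R (\<lambda>u v. (\<phi> u, \<phi> v) \<in> H)) / (2 * real n ^ 2) \<le> D + \<delta> / 2"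
    using distance_to_P4_free_template[OF E \<delta> K n] unfolding D_def by blast
  then have opt: "cost n ?R H \<phi> \<le> (2 * D + \<delta>) * (real n)\<^sup>2"
    using n2 by (simp add: cost[OF H] divide_le_eq algebra_simps)
  let ?Q = "\<lambda>j t. replicate_pmf j (replicate_pmf t (pmf_of_set {..<n}))"
  have fin: "finite (set_pmf (?Q j t))" for j t
    using n by (intro finite_set_replicate_pmf) (auto simp: set_pmf_of_set lessThan_empty_iff)
  let ?out = "\<lambda>Us Ws. (estimate ?R K m t s Us Ws, (m * t + 2 * s)\<^sup>2)"
  have "measure_pmf.prob (run E (sampling_alg n K m t s)) (- ?A) \<le> 1 / 6 + 1 / 6"
    unfolding run_sampling_alg[OF n m]
  proof (rule prob_bind_pmf_le[OF fin _ good_candidate[OF sym irr n m K0 \<tau> t \<epsilon> lower H \<phi> opt small]])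
    fix Us
    assume "Us \<notin> {Us. \<not> (\<exists>(H, Ls)\<in>candidates K m t.
       cost n ?R H (extend_labels ?R H K m Us Ls) \<le> (2 * D + \<epsilon>) * (real n)\<^sup>2)}"
    then have good: "\<exists>(H, Ls)\<in>candidates K m t.
       cost n ?R H (extend_labels ?R H K m Us Ls) \<le> (2 * D + \<epsilon>) * (real n)\<^sup>2" by blast
    have "measure_pmf.prob (?Q s 2 \<bind> (\<lambda>Ws. return_pmf (?out Us Ws))) (- ?A)
        = measure_pmf.prob (?Q s 2) (?out Us -` (- ?A))"
      by (simp flip: map_pmf_def)
    also have "\<dots> \<le> measure_pmf.prob (?Q s 2) {Ws. \<exists>(H, Ls)\<in>candidates K m t.
        \<epsilon> \<le> \<bar>empirical_cost ?R K m s Us Ws (H, Ls)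
       - cost n ?R H (extend_labels ?R H K m Us Ls) / (real n)\<^sup>2\<bar>}"
      by (intro measure_pmf.finite_measure_mono subsetI)
        (use estimate_accurate[OF n lower good] in \<open>auto simp only: mem_Collect_eq vimage_eq Compl_iff split_conv sets_measure_pmf UNIV_I\<close>)
    also have "\<dots> \<le> 1 / 6" by (rule empirical_cost_accurate[OF n \<epsilon> s])
    finally show "measure_pmf.prob (?Q s 2 \<bind> (\<lambda>Ws. return_pmf (?out Us Ws))) (- ?A) \<le> 1 / 6" .
  qed (use fin in auto)
  moreover have "measure_pmf.prob (run E (sampling_alg n K m t s)) (- ?A)
      = 1 - measure_pmf.prob (run E (sampling_alg n K m t s)) ?A"
    using measure_pmf.prob_compl[of ?A] by (simp add: Compl_eq_Diff_UNIV)
  ultimately show ?thesis unfolding D_def by linarith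
qed

text \<open>The constants make \<open>\<delta> = 6 / K\<close>, \<open>4 K \<tau>\<close> with \<open>\<tau> = 1 / (7776 N\<^sup>2)\<close>, and \<open>2 / m\<close> all equal to
  \<open>1 / (18 N)\<close>, so that the expected excess cost is at most \<open>\<epsilon> / 6\<close>.\<close>

definition p4_distance_alg :: "nat \<Rightarrow> real \<Rightarrow> query_alg" where
  "p4_distance_alg n \<epsilon> = (if n = 0 then Output 0 else
     let N = nat \<lceil>1 / \<epsilon>\<rceil>; K = 108 * N; m = 36 * N; t = 8 * (7776 * N ^ 2) ^ 3
     in sampling_alg n K m t (N ^ 2 * (K * K + K * (m * t) + 11)))"

section \<open>Constants and query bound\<close>

lemma nat_ceiling_inverse_bounds:
  assumes "0 < \<epsilon>" "\<epsilon> < 1"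
  shows "1 \<le> real (nat \<lceil>1 / \<epsilon>\<rceil>)" "1 \<le> real (nat \<lceil>1 / \<epsilon>\<rceil>) * \<epsilon>" "real (nat \<lceil>1 / \<epsilon>\<rceil>) \<le> 1 + 1 / \<epsilon>"
proof -
  have "1 < 1 / \<epsilon>" using assms by simp
  moreover have N: "1 / \<epsilon> \<le> real (nat \<lceil>1 / \<epsilon>\<rceil>)" by linarith
  ultimately show "1 \<le> real (nat \<lceil>1 / \<epsilon>\<rceil>)" by linarith
  show "1 \<le> real (nat \<lceil>1 / \<epsilon>\<rceil>) * \<epsilon>" using mult_right_mono[OF N, of \<epsilon>] assms by simp
  show "real (nat \<lceil>1 / \<epsilon>\<rceil>) \<le> 1 + 1 / \<epsilon>" using \<open>1 < 1 / \<epsilon>\<close> by linarith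
qed

text \<open>The bracket in \<open>s\<close> bounds the logarithm of 12 times the number of
  candidates, by 2 \<le> e, K \<le> exp K and 12 \<le> exp 11. The factor \<open>N ^ 2\<close>
  cancels \<open>\<epsilon>\<^sup>2\<close>.\<close>

lemma card_candidates_exp_le:
  assumes N: "1 \<le> real N * \<epsilon>" and \<epsilon>: "0 < \<epsilon>" and s: "s = N ^ 2 * (K * K + K * (m * t) + 11)"
  shows "12 * real (card (candidates K m t)) * exp (- 2 * real s * \<epsilon>\<^sup>2) \<le> 1"
proof -
  let ?L = "real (K * K) + real (K * (m * t)) + 11"
  have "real (card (candidates K m t)) \<le> real (2 ^ (K * K) * K ^ (m * t))"
    using card_candidates by (simp only: of_nat_le_iff)
  also have "\<dots> = 2 ^ (K * K) * real K ^ (m * t)" by simp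
  also have "\<dots> \<le> exp 1 ^ (K * K) * exp (real K) ^ (m * t)"
  proof (intro mult_mono power_mono)
    show "(2::real) \<le> exp 1" using exp_ge_add_one_self[of 1] by simp
    show "real K \<le> exp (real K)" using exp_ge_add_one_self[of "real K"] by linarith
  qed auto
  also have "\<dots> = exp (real (K * K) + real (K * (m * t)))"
    by (simp add: exp_add mult_ac flip: exp_of_nat_mult)
  finally have "12 * real (card (candidates K m t)) \<le> exp 11 * exp (real (K * K) + real (K * (m * t)))"
    using exp_ge_add_one_self[of 11] by (intro mult_mono) auto
  also have "\<dots> = exp ?L" by (simp add: mult.commute flip: exp_add)
  also have "\<dots> \<le> exp (2 * real s * \<epsilon>\<^sup>2)"
  proof -
    have "1 \<le> (real N * \<epsilon>)\<^sup>2" using N by (simp add: one_le_power)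
    then have "?L * 1 \<le> ?L * (real N * \<epsilon>)\<^sup>2" by (intro mult_left_mono) auto
    also have "\<dots> = real s * \<epsilon>\<^sup>2" by (simp add: s power_mult_distrib)
    also have "\<dots> \<le> 2 * real s * \<epsilon>\<^sup>2" by simp
    finally show ?thesis by simp
  qed
  finally have "12 * real (card (candidates K m t)) * exp (- 2 * real s * \<epsilon>\<^sup>2)
      \<le> exp (2 * real s * \<epsilon>\<^sup>2) * exp (- 2 * real s * \<epsilon>\<^sup>2)" by (intro mult_right_mono) auto
  also have "\<dots> = 1" by (simp flip: exp_add)
  finally show ?thesis .
qed

text \<open>Division by zero gives 0 here. This case is separate because there is no vertex to
  draw.\<close>

lemma distance_to_property_no_vertices: "distance_to_property induced_P4_free {..<0::nat} E = 0"
proof -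
  have "{} \<in> {E'. simple_graph {..<0::nat} E' \<and> induced_P4_free {..<0} E'}"
    using induced_P4_free_iff[of "{}" "{..<0::nat}"] by (simp add: simple_graph_def p4_free_on_def)
  then have "graph_distance {..<0::nat} E ` {E'. simple_graph {..<0} E' \<and> induced_P4_free {..<0} E'} = {0}"
    by (auto simp: graph_distance_def)
  then show ?thesis by (simp add: distance_to_property_def)
qed

lemma distance_approximation_p4_distance_alg:
  "distance_approximation_algorithm induced_P4_free p4_distance_alg"
  unfolding distance_approximation_algorithm_def
proof (intro allI impI, elim conjE)
  fix n :: nat and E :: "nat set set" and \<epsilon> :: real
  assume E: "simple_graph {..<n} E" and \<epsilon>: "0 < \<epsilon>" "\<epsilon> < 1"
  show "measure_pmf.prob (run E (p4_distance_alg n \<epsilon>))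
      {(d, q). \<bar>d - distance_to_property induced_P4_free {..<n} E\<bar> \<le> \<epsilon>} \<ge> 2 / 3"
  proof (cases "n = 0")
    case True
    then show ?thesis using \<epsilon> distance_to_property_no_vertices[of E]
      by (simp add: p4_distance_alg_def indicator_def)
  next
    case False
    define N where "N = nat \<lceil>1 / \<epsilon>\<rceil>"
    define K where "K = 108 * N"
    define m where "m = 36 * N"
    define t where "t = 8 * (7776 * N ^ 2) ^ 3"
    define s where "s = N ^ 2 * (K * K + K * (m * t) + 11)"
    have N: "1 \<le> real N" "1 \<le> real N * \<epsilon>"
      unfolding N_def by (rule nat_ceiling_inverse_bounds[OF \<epsilon>])+
    then have N0: "0 < N" by simp
    have "measure_pmf.prob (run E (sampling_alg n K m t s))
      {(d, q). \<bar>d - distance_to_property induced_P4_free {..<n} E\<bar> \<le> \<epsilon>} \<ge> 2 / 3"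
    proof (rule sampling_alg_accurate[OF E, where \<delta> = "1 / (18 * real N)" and \<tau> = "1 / (7776 * (real N)\<^sup>2)"])
      show "8 / (1 / (7776 * (real N)\<^sup>2)) ^ 3 \<le> real t"
        by (simp add: t_def power_divide)
      have "1 / (18 * real N) + 4 * real K * (1 / (7776 * (real N)\<^sup>2)) + 2 / real m = 1 / (6 * real N)"
        using N0 by (simp add: K_def m_def field_simps power2_eq_square)
      also have "\<dots> \<le> \<epsilon> / 6" using N N0 by (simp add: field_simps)
      finally show "1 / (18 * real N) + 4 * real K * (1 / (7776 * (real N)\<^sup>2)) + 2 / real m \<le> \<epsilon> / 6" .
      show "12 * real (card (candidates K m t)) * exp (- 2 * real s * \<epsilon>\<^sup>2) \<le> 1"
        by (rule card_candidates_exp_le[OF N(2) \<epsilon>(1) s_def])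
      show "6 / (1 / (18 * real N)) \<le> real K" by (simp add: K_def)
      show "1 / (18 * real N) \<le> 1" using N(1) by simp
    qed (use False N0 \<epsilon> in \<open>simp_all add: m_def s_def\<close>)
    then show ?thesis
      using False by (simp add: p4_distance_alg_def Let_def N_def K_def m_def t_def s_def)
  qed
qed

lemma poly_query_complexity_p4_distance_alg: "poly_query_complexity p4_distance_alg"
proof -
  define f :: "real \<Rightarrow> real" where "f y = (36 * y * (8 * (7776 * y ^ 2) ^ 3)
     + 2 * (y ^ 2 * (108 * y * (108 * y) + 108 * y * (36 * y * (8 * (7776 * y ^ 2) ^ 3)) + 11)))\<^sup>2" for y
  \<comment> \<open>The polynomial 1 + x stands for \<open>N\<close>, which is at most 1 +
    1/\<epsilon>; \<open>f\<close> is the exact query count as a monotone function of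
    \<open>N\<close>.\<close>
  define X :: "real poly" where "X = [:1, 1:]"
  define p :: "real poly" where "p = (36 * X * (8 * (7776 * X ^ 2) ^ 3)
     + 2 * (X ^ 2 * (108 * X * (108 * X) + 108 * X * (36 * X * (8 * (7776 * X ^ 2) ^ 3)) + 11))) ^ 2"
  have p: "poly p x = f (1 + x)" for x
    by (simp add: p_def X_def f_def mult.commute[of x])
  have mono: "f x \<le> f y" if "0 \<le> x" "x \<le> y" for x y
    unfolding f_def by (intro power_mono add_mono mult_mono order_refl) (use that in auto)
  show ?thesis unfolding poly_query_complexity_def
  proof (intro exI[of _ p] allI impI ballI, clarify)
    fix n :: nat and E :: "nat set set" and \<epsilon> d :: real and q :: nat
    assume \<epsilon>: "0 < \<epsilon>" "\<epsilon> < 1" and dq: "(d, q) \<in> set_pmf (run E (p4_distance_alg n \<epsilon>))"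
    show "real q \<le> poly p (1 / \<epsilon>)"
    proof (cases "n = 0")
      case True
      then have "q = 0" using dq by (simp add: p4_distance_alg_def)
      then show ?thesis by (simp add: p f_def)
    next
      case False
      define N where "N = nat \<lceil>1 / \<epsilon>\<rceil>"
      have N: "1 \<le> real N" "real N \<le> 1 + 1 / \<epsilon>"
        unfolding N_def by (rule nat_ceiling_inverse_bounds[OF \<epsilon>])+
      then have "real q = f (real N)"
        using dq False by (auto simp: p4_distance_alg_def Let_def run_sampling_alg f_def simp flip: N_def)
      also have "\<dots> \<le> poly p (1 / \<epsilon>)" unfolding p using N by (intro mono) auto
      finally show ?thesis .
    qed
  qed
qed

theorem theorem1p4:
  "\<exists>A. distance_approximation_algorithm induced_P4_free A \<and> poly_query_complexity A"
  using distance_approximation_p4_distance_alg poly_query_complexity_p4_distance_alg by blast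

end
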